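(* For all positive integers $m,n$, the set $\mathcal{D}_n^{\mathrm{gen}(m)}$ consists of exactly the $m\times(n+1)$ matrices with entries in $\{0,1\}$ such that for all $k\in\{0,1,\ldots,n\}$ there are at most $k$ nonzero entries in the last $k+1$ columns.
   Context: For a polynomial $P\in\mathbb{C}[x]$ of degree exactly $n$ and an $m$-tuple $\Lambda=(\lambda_1,\ldots,\lambda_m)$ of distinct complex numbers, the dope matrix $D_P(\Lambda)$ is the $m\times(n+1)$ matrix $(c_{ij})$, with rows indexed by $i\in\{1,\ldots,m\}$ and columns indexed by $j\in\{0,1,\ldots,n\}$, where $c_{ij}=1$ if $P^{(j)}(\lambda_i)=0$ and $c_{ij}=0$ otherwise ($P^{(j)}$ is the $j$th derivative). For fixed $\Lambda$ and $n$ put $\mathcal{D}_n(\Lambda)=\{D_P(\Lambda): P\in\mathbb{C}[x],\ \deg P=n\}$. An affine algebraic dependence of $\Lambda$ is a polynomial $R\in\mathbb{Q}[x_1,\ldots,x_m]$ with $R(a+b\lambda_1,\ldots,a+b\lambda_m)=0$ for all $a,b\in\mathbb{C}$. $\Lambda$ is affinely algebraically independent if its only affine algebraic dependence is $R\equiv 0$. The set $\mathcal{D}_n(\Lambda)$ is the same for every affinely algebraically independent $m$-tuple $\Lambda$, and this common set is denoted $\mathcal{D}_n^{\mathrm{gen}(m)}$. *)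

theory Defs
  imports
    Complex_Main
    "HOL-Computational_Algebra.Polynomial"
    "HOL-Library.Poly_Mapping"
    "Jordan_Normal_Form.Matrix"
begin

text \<open>
  Tuples of complex numbers are lists, and rows and variables are numbered from 0: row \<open>i\<close>
  of a dope matrix and the variable with index \<open>i\<close> belong to \<open>\<Lambda> ! i\<close>. Columns are numbered
  \<open>0, \<dots>, n\<close> by the order of the derivative.
\<close>

definition dope_matrix :: "complex list \<Rightarrow> complex poly \<Rightarrow> nat mat" where
  "dope_matrix \<Lambda> P =
     mat (length \<Lambda>) (degree P + 1)
       (\<lambda>(i, j). if poly ((pderiv ^^ j) P) (\<Lambda> ! i) = 0 then 1 else 0)"

text \<open>The zero polynomial is excluded since its library degree is 0.\<close>

definition dope_set :: "nat \<Rightarrow> complex list \<Rightarrow> nat mat set" where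
  "dope_set n \<Lambda> = {dope_matrix \<Lambda> P | P. P \<noteq> 0 \<and> degree P = n}"

text \<open>
  A multivariate polynomial over the rationals maps each exponent vector (variable index to
  exponent, finitely supported) to its coefficient.
\<close>

type_synonym rat_mpoly = "(nat \<Rightarrow>\<^sub>0 nat) \<Rightarrow>\<^sub>0 rat"

definition in_variables :: "nat \<Rightarrow> rat_mpoly \<Rightarrow> bool" where
  "in_variables m R \<longleftrightarrow> (\<forall>\<mu> \<in> Poly_Mapping.keys R. Poly_Mapping.keys \<mu> \<subseteq> {..<m})"

definition eval_mpoly :: "rat_mpoly \<Rightarrow> (nat \<Rightarrow> complex) \<Rightarrow> complex" where
  "eval_mpoly R x =
     (\<Sum>\<mu> \<in> Poly_Mapping.keys R.
        of_rat (Poly_Mapping.lookup R \<mu>) *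
        (\<Prod>i \<in> Poly_Mapping.keys \<mu>. x i ^ Poly_Mapping.lookup \<mu> i))"

definition affine_algebraic_dependence :: "complex list \<Rightarrow> rat_mpoly \<Rightarrow> bool" where
  "affine_algebraic_dependence \<Lambda> R \<longleftrightarrow>
     in_variables (length \<Lambda>) R \<and>
     (\<forall>a b :: complex. eval_mpoly R (\<lambda>i. a + b * \<Lambda> ! i) = 0)"

definition affinely_algebraically_independent :: "complex list \<Rightarrow> bool" where
  "affinely_algebraically_independent \<Lambda> \<longleftrightarrow>
     (\<forall>R. affine_algebraic_dependence \<Lambda> R \<longrightarrow> R = 0)"

definition generic_tuples :: "nat \<Rightarrow> complex list set" where
  "generic_tuples m =
     {\<Lambda>. length \<Lambda> = m \<and> distinct \<Lambda> \<and> affinely_algebraically_independent \<Lambda>}"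

text \<open>
  The common value of \<open>dope_set n \<Lambda>\<close> over all generic \<open>m\<close>-tuples; meaningful only once this set
  of values is known to be a singleton.
\<close>

definition generic_dope_set :: "nat \<Rightarrow> nat \<Rightarrow> nat mat set" where
  "generic_dope_set m n = (THE D. dope_set n ` generic_tuples m = {D})"

end

theory Submission
  imports Defs "HOL-Analysis.Continuum_Not_Denumerable"
begin

text \<open>
  Both inclusions come down to Birkhoff interpolation. A pair \<open>(i, j)\<close> stands for the linear
  condition \<open>P\<^sup>(\<^sup>j\<^sup>)(\<lambda>\<^sub>i) = 0\<close> on the space of polynomials of degree less than \<open>N\<close>. For a set of such
  conditions to be linearly independent, at most \<open>N - k\<close> of them may have order \<open>j \<ge> k\<close>, for every
  \<open>k\<close>: this is the Polya condition. The heart of the proof is that for generic nodes it suffices: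
  \<open>N\<close> conditions that satisfy it force \<open>P = 0\<close> (lemma
  \<open>poised_of_affinely_algebraically_independent\<close>).

  Necessity of the bound on the matrices: if it fails, let \<open>k\<close> be the least index where it fails. Then
  \<open>k + 1\<close> of the conditions on the derivative of \<open>P\<close> of order \<open>n - k\<close>, which has degree \<open>k\<close>, satisfy
  the Polya condition with \<open>N = k + 1\<close>, and this derivative is zero, which is absurd. Sufficiency:
  the prescribed zero conditions leave room for one more, so for each entry that is to be nonzero
  there is a polynomial with all prescribed zeros for which that entry is nonzero. A suitable linear
  combination has all these entries nonzero at once.

  By elimination, unique solvability at a tuple of nodes follows from the nonvanishing there of some
  polynomial with rational coefficients, which can be chosen nonzero as soon as one good tuple exists.
  Affine maps of the nodes do not affect solvability, so every generic tuple is good if one tuple is.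

  One good tuple is built node by node (theorem \<open>exists_poised_nodes\<close>), each new node being sent
  to infinity. Let \<open>V\<close> be the space of polynomials that satisfy the conditions at the previous
  nodes. Rescaled so that the new node becomes 1, the space \<open>V\<close> tends to the span of the powers
  \<open>x\<^sup>d\<close> where \<open>d\<close> runs through the degrees that occur in \<open>V\<close>. The induction hypothesis shows that
  below any bound there are at most as many of these degrees as there are orders of conditions at
  the new node. In the limit, therefore, solvability is the statement that a nonzero polynomial with
  \<open>t\<close> terms has fewer than \<open>t\<close> vanishing derivatives at 1, counting orders up to its degree
  (lemma \<open>card_vanishing_derivs_less_card_support\<close>), and this is a consequence of Rolle's theorem.

  Finally, generic tuples exist, since there are only countably many rational polynomials to avoid.
\<close>

section \<open>Linear systems with trivial kernel\<close>

definition trivial_kernel :: "'a set \<Rightarrow> 'b set \<Rightarrow> ('a \<Rightarrow> 'b \<Rightarrow> 'c::field) \<Rightarrow> bool" where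
  "trivial_kernel A B M \<longleftrightarrow>
     (\<forall>c. (\<forall>b\<in>B. (\<Sum>a\<in>A. c a * M a b) = 0) \<longrightarrow> (\<forall>a\<in>A. c a = 0))"

text \<open>
  One step of fraction-free Gaussian elimination. The new entries are polynomials in the old
  ones, so elimination keeps the entries inside any ring of functions that contains them.
\<close>

lemma trivial_kernel_eliminate:
  fixes M :: "'a \<Rightarrow> 'b \<Rightarrow> 'c::field"
  assumes A: "finite A" "a \<notin> A" and b: "b \<in> B" "M a b \<noteq> 0"
  shows "trivial_kernel (insert a A) B M \<longleftrightarrow>
         trivial_kernel A B (\<lambda>a' b'. M a b * M a' b' - M a' b * M a b')"
proof -
  have sum_eq: "(\<Sum>a'\<in>A. c a' * (M a b * M a' b' - M a' b * M a b'))
      = M a b * (\<Sum>a'\<in>A. c a' * M a' b') - M a b' * (\<Sum>a'\<in>A. c a' * M a' b)" for c b'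
    by (simp add: sum_distrib_left sum_subtractf[symmetric] algebra_simps)
  show ?thesis
  proof
    assume tk: "trivial_kernel (insert a A) B M"
    show "trivial_kernel A B (\<lambda>a' b'. M a b * M a' b' - M a' b * M a b')"
      unfolding trivial_kernel_def
    proof (intro allI impI)
      fix c
      assume 0: "\<forall>b'\<in>B. (\<Sum>a'\<in>A. c a' * (M a b * M a' b' - M a' b * M a b')) = 0"
      define c' where "c' = c(a := - (\<Sum>a'\<in>A. c a' * M a' b) / M a b)"
      have eq: "(\<Sum>a'\<in>A. c' a' * M a' b') = (\<Sum>a'\<in>A. c a' * M a' b')" for b'
        by (rule sum.cong) (use A in \<open>auto simp: c'_def\<close>)
      have "(\<Sum>a'\<in>insert a A. c' a' * M a' b') = 0" if "b' \<in> B" for b'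
      proof -
        have "M a b * (\<Sum>a'\<in>A. c a' * M a' b') = M a b' * (\<Sum>a'\<in>A. c a' * M a' b)"
          using 0 that by (simp add: sum_eq)
        then show ?thesis
          using A b by (simp add: eq) (simp add: c'_def field_simps)
      qed
      then have "\<forall>a'\<in>insert a A. c' a' = 0"
        using tk by (auto simp: trivial_kernel_def)
      then show "\<forall>a'\<in>A. c a' = 0"
        using A by (auto simp: c'_def split: if_splits)
    qed
  next
    assume tk: "trivial_kernel A B (\<lambda>a' b'. M a b * M a' b' - M a' b * M a b')"
    show "trivial_kernel (insert a A) B M"
      unfolding trivial_kernel_def
    proof (intro allI impI)
      fix c
      assume 0: "\<forall>b'\<in>B. (\<Sum>a'\<in>insert a A. c a' * M a' b') = 0"
      have s: "(\<Sum>a'\<in>A. c a' * M a' b') = - (c a * M a b')" if "b' \<in> B" for b'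
        using 0 that A by (simp add: add_eq_0_iff)
      have "\<forall>b'\<in>B. (\<Sum>a'\<in>A. c a' * (M a b * M a' b' - M a' b * M a b')) = 0"
        unfolding sum_eq using s b by simp
      then have z: "\<forall>a'\<in>A. c a' = 0" using tk by (simp add: trivial_kernel_def)
      moreover have "c a = 0" using s[OF b(1)] z b(2) by simp
      ultimately show "\<forall>a'\<in>insert a A. c a' = 0" by simp
    qed
  qed
qed

lemma trivial_kernel_insert_nonzero:
  assumes "finite A" "a \<notin> A" "trivial_kernel (insert a A) B M"
  obtains b where "b \<in> B" "M a b \<noteq> 0"
proof -
  have False if "\<forall>b\<in>B. M a b = 0"
  proof -
    have "(\<Sum>a'\<in>A. (if a' = a then 1 else 0) * M a' b) = 0" for b
      by (rule sum.neutral) (use assms in auto)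
    then have "\<forall>b\<in>B. (\<Sum>a'\<in>insert a A. (if a' = a then 1 else 0) * M a' b) = 0"
      using that assms by simp
    then show False
      using assms(3)[unfolded trivial_kernel_def, rule_format, of "\<lambda>a'. if a' = a then 1 else 0" a]
      by simp
  qed
  then show thesis using that by blast
qed

text \<open>
  Elimination run at \<open>x0\<close> uses finitely many nonzero pivots. Their product \<open>r\<close> lies in the ring
  \<open>S\<close>, and wherever it does not vanish the same elimination goes through. For continuous
  functions this says that a trivial kernel survives small perturbations; for polynomial
  functions it says that a trivial kernel is detected by one polynomial. It takes the place of
  a nonvanishing maximal minor.
\<close>

lemma trivial_kernel_open_condition:
  fixes S :: "('x \<Rightarrow> 'c::field) set" and M :: "'a \<Rightarrow> 'b \<Rightarrow> 'x \<Rightarrow> 'c"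
  assumes "finite A"
    and one: "(\<lambda>_. 1) \<in> S"
    and mult: "\<And>f g. f \<in> S \<Longrightarrow> g \<in> S \<Longrightarrow> (\<lambda>x. f x * g x) \<in> S"
    and diff: "\<And>f g. f \<in> S \<Longrightarrow> g \<in> S \<Longrightarrow> (\<lambda>x. f x - g x) \<in> S"
    and "\<And>a b. a \<in> A \<Longrightarrow> b \<in> B \<Longrightarrow> M a b \<in> S"
    and "trivial_kernel A B (\<lambda>a b. M a b x0)"
  shows "\<exists>r\<in>S. r x0 \<noteq> 0 \<and> (\<forall>x. r x \<noteq> 0 \<longrightarrow> trivial_kernel A B (\<lambda>a b. M a b x))"
  using assms(1,5,6)
proof (induction A arbitrary: M rule: finite_induct)
  case empty
  show ?case by (rule bexI[OF _ one]) (auto simp: trivial_kernel_def)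
next
  case (insert a A)
  obtain b where b: "b \<in> B" "M a b x0 \<noteq> 0"
    using trivial_kernel_insert_nonzero[OF insert.hyps insert.prems(2)] by blast
  define M' where "M' = (\<lambda>a' b' x. M a b x * M a' b' x - M a' b x * M a b' x)"
  have "M' a' b' \<in> S" if "a' \<in> A" "b' \<in> B" for a' b'
    unfolding M'_def by (intro diff mult insert.prems(1)) (use that b in auto)
  moreover have "trivial_kernel A B (\<lambda>a' b'. M' a' b' x0)"
    using trivial_kernel_eliminate[of A a b B "\<lambda>a b. M a b x0"] insert b by (simp add: M'_def)
  ultimately obtain r where r: "r \<in> S" "r x0 \<noteq> 0"
    "\<And>x. r x \<noteq> 0 \<Longrightarrow> trivial_kernel A B (\<lambda>a' b'. M' a' b' x)"
    using insert.IH[of M'] by blast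
  show ?case
  proof (intro bexI conjI allI impI)
    show "(\<lambda>x. M a b x * r x) \<in> S" using mult insert.prems(1) b r(1) by blast
    show "M a b x0 * r x0 \<noteq> 0" using b r by simp
  next
    fix x assume "M a b x * r x \<noteq> 0"
    then show "trivial_kernel (insert a A) B (\<lambda>a b. M a b x)"
      using trivial_kernel_eliminate[of A a b B "\<lambda>a b. M a b x"] insert.hyps b r(3)[of x]
      by (simp add: M'_def)
  qed
qed

text \<open>
  A homogeneous system with more unknowns than equations has a nonzero solution: each
  elimination step removes one unknown and one equation.
\<close>

lemma trivial_kernel_card_le:
  fixes M :: "'a \<Rightarrow> 'b \<Rightarrow> 'c::field"
  assumes "finite A" "finite B" "trivial_kernel A B M"
  shows "card A \<le> card B"
  using assms(1,3,2)
proof (induction A arbitrary: M B rule: finite_induct)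
  case empty
  then show ?case by simp
next
  case (insert a A)
  obtain b where b: "b \<in> B" "M a b \<noteq> 0"
    using trivial_kernel_insert_nonzero[OF insert.hyps insert.prems(1)] by blast
  let ?M' = "\<lambda>a' b'. M a b * M a' b' - M a' b * M a b'"
  have "trivial_kernel A B ?M'"
    using trivial_kernel_eliminate[of A a b B M] insert b by simp
  \<comment> \<open>The elimination has made the equation \<open>b\<close> void.\<close>
  moreover have "trivial_kernel A B ?M' \<Longrightarrow> trivial_kernel A (B - {b}) ?M'"
  proof -
    have "(\<Sum>a'\<in>A. c a' * ?M' a' b) = 0" for c by (simp add: mult.commute)
    then have "(\<forall>b'\<in>B. (\<Sum>a'\<in>A. c a' * ?M' a' b') = 0) \<longleftrightarrow>
               (\<forall>b'\<in>B - {b}. (\<Sum>a'\<in>A. c a' * ?M' a' b') = 0)" for c by blast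
    then show "trivial_kernel A B ?M' \<Longrightarrow> trivial_kernel A (B - {b}) ?M'"
      unfolding trivial_kernel_def by blast
  qed
  ultimately have "card A \<le> card (B - {b})" using insert by simp
  moreover have "card B = Suc (card (B - {b}))"
    using insert.prems(2) b(1) by (rule card.remove)
  ultimately show ?case using insert.hyps by simp
qed

section \<open>Sparse polynomials and vanishing derivatives at one\<close>

text \<open>
  Rolle's theorem between consecutive points of \<open>S\<close>.
\<close>

lemma poly_rolle_count:
  fixes p :: "real poly"
  assumes "finite S" "S \<noteq> {}" "S \<subseteq> {a..b}" "\<And>x. x \<in> S \<Longrightarrow> poly p x = 0"
  shows "\<exists>T\<subseteq>{a<..<b}. finite T \<and> Suc (card T) = card S \<and> (\<forall>x\<in>T. poly (pderiv p) x = 0)"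
  using assms
proof (induction S arbitrary: b rule: finite_linorder_max_induct)
  case empty
  then show ?case by simp
next
  case (insert y S)
  show ?case
  proof (cases "S = {}")
    case True
    then show ?thesis by (intro exI[of _ "{}"]) auto
  next
    case False
    define z where "z = Max S"
    have z: "z \<in> S" "z < y" "S \<subseteq> {a..z}" using insert False by (auto simp: z_def)
    then obtain T where T: "T \<subseteq> {a<..<z}" "finite T" "Suc (card T) = card S"
      "\<forall>x\<in>T. poly (pderiv p) x = 0"
      using insert.IH[of z] insert.prems False by auto
    obtain w where w: "z < w" "w < y" "poly p y - poly p z = (y - z) * poly (pderiv p) w"
      using poly_MVT[OF z(2)] by blast
    have "poly (pderiv p) w = 0" using w z insert.prems by auto
    moreover have "w \<notin> T" using T w by auto
    ultimately show ?thesis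
      using T w z insert by (intro exI[of _ "insert w T"]) auto
  qed
qed

lemma finite_coeff_support: "finite {d. coeff p d \<noteq> 0}"
  by (rule finite_subset[of _ "{..degree p}"]) (auto simp: le_degree)

text \<open>
  The roots in the open unit interval are counted only to make the induction on the degree
  work. Passing from \<open>p\<close> to its derivative loses a term exactly when \<open>p\<close> does not vanish at 0, and
  loses a vanishing order exactly when \<open>p\<close> vanishes at 1. The critical case is a \<open>p\<close> that vanishes at
  both ends: it has one vanishing order more than its derivative but no more terms, and Rolle's
  theorem makes up for this with one more root of the derivative.
\<close>

lemma card_vanishing_derivs_less_card_support_real:
  fixes p :: "real poly"
  assumes "p \<noteq> 0"
  shows "card {j. j \<le> degree p \<and> poly ((pderiv ^^ j) p) 1 = 0}
           + card {x. 0 < x \<and> x < 1 \<and> poly p x = 0} < card {d. coeff p d \<noteq> 0}"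
  using assms
proof (induction "degree p" arbitrary: p)
  case 0
  then obtain c where "p = [:c:]" "c \<noteq> 0" by (metis degree_eq_zeroE pCons_0_0)
  then have sets: "{d. coeff p d \<noteq> 0} = {0}" "{j. j \<le> degree p \<and> poly ((pderiv ^^ j) p) 1 = 0} = {}"
    "{x. 0 < x \<and> x < 1 \<and> poly p x = 0} = {}"
    by (auto simp: coeff_pCons split: nat.splits) (metis not0_implies_Suc)
  show ?case unfolding sets by simp
next
  case (Suc n)
  define q where "q = pderiv p"
  have q: "n = degree q" "q \<noteq> 0" using Suc(2) by (auto simp: q_def degree_pderiv pderiv_eq_0_iff)
  define Z where "Z p = {j. j \<le> degree p \<and> poly ((pderiv ^^ j) p) 1 = 0}" for p :: "real poly"
  define R where "R p = {x. 0 < x \<and> x < 1 \<and> poly p x = 0}" for p :: "real poly"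
  define N where "N p = {d. coeff p d \<noteq> 0}" for p :: "real poly"
  have fin: "finite (Z p)" "finite (R p)" "finite (N p)" if "p \<noteq> 0" for p
    using finite_coeff_support[of p] poly_roots_finite[OF that]
    by (auto simp: Z_def R_def N_def elim: rev_finite_subset)
  have IH: "card (Z q) + card (R q) < card (N q)"
    using Suc.hyps(1)[OF q] by (simp add: Z_def R_def N_def)
  have "N p = Suc ` N q \<union> (if poly p 0 = 0 then {} else {0})"
  proof (rule Set.set_eqI)
    fix d show "d \<in> N p \<longleftrightarrow> d \<in> Suc ` N q \<union> (if poly p 0 = 0 then {} else {0})"
      by (cases d) (auto simp: N_def q_def coeff_pderiv poly_0_coeff_0)
  qed
  then have N: "card (N p) = card (N q) + (if poly p 0 = 0 then 0 else 1)"
    using fin[OF q(2)] by (simp add: card_image)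
  have "Z p = Suc ` Z q \<union> (if poly p 1 = 0 then {0} else {})"
  proof (rule Set.set_eqI)
    fix d show "d \<in> Z p \<longleftrightarrow> d \<in> Suc ` Z q \<union> (if poly p 1 = 0 then {0} else {})"
      using q(1) Suc(2) by (cases d) (auto simp: Z_def q_def funpow_Suc_right simp del: funpow.simps(2))
  qed
  then have Z: "card (Z p) = card (Z q) + (if poly p 1 = 0 then 1 else 0)"
    using fin[OF q(2)] by (simp add: card_image)
  define S where "S = R p \<union> (if poly p 0 = 0 then {0} else {}) \<union> (if poly p 1 = 0 then {1} else {})"
  have "card S = card (R p) + (if poly p 0 = 0 then 1 else 0) + (if poly p 1 = 0 then 1 else 0)"
    using fin(2)[OF Suc.prems] by (auto simp: S_def R_def)
  moreover have "card S \<le> Suc (card (R q))"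
  proof (cases "S = {}")
    case False
    have "finite S" "S \<subseteq> {0..1}" "\<And>x. x \<in> S \<Longrightarrow> poly p x = 0"
      using fin(2)[OF Suc.prems] by (auto simp: S_def R_def split: if_splits)
    then obtain T where T: "T \<subseteq> {0<..<1}" "Suc (card T) = card S" "\<forall>x\<in>T. poly q x = 0"
      using poly_rolle_count[of S 0 1 p] False unfolding q_def by auto
    then have "card T \<le> card (R q)"
      using fin(2)[OF q(2)] by (intro card_mono) (auto simp: R_def)
    then show ?thesis using T by simp
  qed simp
  ultimately have "card (Z p) + card (R p) < card (N p)"
    using IH N Z by (simp split: if_splits)
  then show ?case by (simp add: Z_def R_def N_def)
qed

text \<open>
  The falling factorial \<open>d (d - 1) \<dots> (d - j + 1)\<close>, as a natural number so that it can be
  read both as a complex and as a rational constant.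
\<close>

definition falling_fact :: "nat \<Rightarrow> nat \<Rightarrow> nat" where
  "falling_fact d j = (if j \<le> d then pochhammer (Suc (d - j)) j else 0)"

lemma poly_higher_pderiv_monom:
  fixes c z :: "'a :: {comm_ring_1, semiring_no_zero_divisors}"
  shows "poly ((pderiv ^^ j) (monom c d)) z = c * of_nat (falling_fact d j) * z ^ (d - j)"
proof (cases "j \<le> d")
  case True
  have "(pderiv ^^ j) (monom c d) = monom (c * of_nat (falling_fact d j)) (d - j)"
    using True by (intro poly_eqI)
      (auto simp: coeff_higher_pderiv falling_fact_def pochhammer_of_nat[symmetric] simp del: of_nat_Suc)
  then show ?thesis by (simp add: poly_monom)
next
  case False
  have "(pderiv ^^ j) (monom c d) = 0"
    using False by (intro poly_eqI) (auto simp: coeff_higher_pderiv)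
  then show ?thesis using False by (simp add: falling_fact_def)
qed

lemma poly_higher_pderiv_sum_monom:
  fixes c :: "nat \<Rightarrow> 'a :: {comm_ring_1, semiring_no_zero_divisors}"
  shows "poly ((pderiv ^^ j) (\<Sum>d\<in>D. monom (c d) d)) z
         = (\<Sum>d\<in>D. c d * of_nat (falling_fact d j) * z ^ (d - j))"
  by (simp add: higher_pderiv_sum poly_sum poly_higher_pderiv_monom)

lemma poly_as_sum_monom_support:
  assumes "finite D" "\<And>d. d \<notin> D \<Longrightarrow> coeff P d = 0"
  shows "P = (\<Sum>d\<in>D. monom (coeff P d) d)"
  using assms by (intro poly_eqI) (auto simp: coeff_sum)

text \<open>
  The conditions at 1 have real coefficients, so after the leading coefficient has been made 1
  the real part of \<open>p\<close> has the same degree, no new terms, and satisfies the same conditions.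
\<close>

lemma card_vanishing_derivs_less_card_support:
  fixes p :: "complex poly"
  assumes "p \<noteq> 0"
  shows "card {j. j \<le> degree p \<and> poly ((pderiv ^^ j) p) 1 = 0} < card {d. coeff p d \<noteq> 0}"
proof -
  define q where "q = Polynomial.smult (inverse (lead_coeff p)) p"
  define r where "r = (\<Sum>d\<le>degree p. monom (Re (coeff q d)) d)"
  have q: "q = (\<Sum>d\<le>degree p. monom (coeff q d) d)"
    by (rule poly_as_sum_monom_support) (auto simp: q_def coeff_eq_0)
  have coeff_r: "coeff r d = Re (coeff q d)" for d
    by (auto simp: r_def coeff_sum q_def coeff_eq_0)
  have "coeff q (degree p) = 1" using assms by (simp add: q_def)
  then have deg: "coeff r (degree p) \<noteq> 0" by (simp add: coeff_r)
  have deg': "degree r = degree p"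
  proof (rule antisym)
    show "degree r \<le> degree p" by (rule degree_le) (simp add: coeff_r q_def coeff_eq_0)
    show "degree p \<le> degree r" by (rule le_degree[OF deg])
  qed
  have "poly ((pderiv ^^ j) r) 1 = Re (poly ((pderiv ^^ j) q) 1)" for j
    unfolding r_def by (subst q) (simp add: poly_higher_pderiv_sum_monom)
  then have sub: "{j. j \<le> degree p \<and> poly ((pderiv ^^ j) p) 1 = 0}
      \<subseteq> {j. j \<le> degree r \<and> poly ((pderiv ^^ j) r) 1 = 0}"
    by (auto simp: deg' q_def higher_pderiv_smult)
  have "card {j. j \<le> degree p \<and> poly ((pderiv ^^ j) p) 1 = 0}
      \<le> card {j. j \<le> degree r \<and> poly ((pderiv ^^ j) r) 1 = 0}"
    by (rule card_mono[OF _ sub]) simp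
  also have "\<dots> < card {d. coeff r d \<noteq> 0}"
    using card_vanishing_derivs_less_card_support_real[of r] deg by fastforce
  also have "\<dots> \<le> card {d. coeff p d \<noteq> 0}"
    by (rule card_mono[OF finite_coeff_support]) (auto simp: coeff_r q_def)
  finally show ?thesis .
qed

section \<open>Nodes at which Birkhoff interpolation is uniquely solvable\<close>

text \<open>
  A pair \<open>(i, j)\<close> stands for the condition that the \<open>j\<close>th derivative vanishes at the \<open>i\<close>th node,
  imposed on the \<open>N\<close>-dimensional space of polynomials of degree less than \<open>N\<close>. This is the Polya
  condition of Birkhoff interpolation: conditions with \<open>j \<ge> k\<close> see only the \<open>k\<close>th derivative,
  which ranges over a space of dimension \<open>N - k\<close>.
\<close>

definition polya :: "nat \<Rightarrow> (nat \<times> nat) set \<Rightarrow> bool" where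
  "polya N E \<longleftrightarrow> finite E \<and> E \<subseteq> UNIV \<times> {..<N} \<and>
     (\<forall>k\<le>N. card {e \<in> E. k \<le> snd e} \<le> N - k)"

definition vanishing_polys :: "(nat \<Rightarrow> complex) \<Rightarrow> nat \<Rightarrow> (nat \<times> nat) set \<Rightarrow> complex poly set" where
  "vanishing_polys x N E = {P. (\<forall>d\<ge>N. coeff P d = 0) \<and>
     (\<forall>(i, j)\<in>E. poly ((pderiv ^^ j) P) (x i) = 0)}"

definition poised :: "(nat \<Rightarrow> complex) \<Rightarrow> nat \<Rightarrow> (nat \<times> nat) set \<Rightarrow> bool" where
  "poised x N E \<longleftrightarrow> vanishing_polys x N E \<subseteq> {0}"

lemma vanishing_polys_add:
  "P \<in> vanishing_polys x N E \<Longrightarrow> Q \<in> vanishing_polys x N E \<Longrightarrow> P + Q \<in> vanishing_polys x N E"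
  by (fastforce simp: vanishing_polys_def higher_pderiv_add)

lemma vanishing_polys_smult:
  "P \<in> vanishing_polys x N E \<Longrightarrow> Polynomial.smult c P \<in> vanishing_polys x N E"
  by (fastforce simp: vanishing_polys_def higher_pderiv_smult)

lemma vanishing_polys_sum:
  "(\<And>a. a \<in> A \<Longrightarrow> f a \<in> vanishing_polys x N E) \<Longrightarrow> sum f A \<in> vanishing_polys x N E"
  by (induction A rule: infinite_finite_induct)
    (auto simp: vanishing_polys_add, auto simp: vanishing_polys_def)

lemma poised_iff_trivial_kernel:
  "poised x N E \<longleftrightarrow> trivial_kernel {..<N} E
     (\<lambda>d e. of_nat (falling_fact d (snd e)) * x (fst e) ^ (d - snd e))"
proof
  assume p: "poised x N E"
  show "trivial_kernel {..<N} E (\<lambda>d e. of_nat (falling_fact d (snd e)) * x (fst e) ^ (d - snd e))"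
    unfolding trivial_kernel_def
  proof (intro allI impI)
    fix c assume 0: "\<forall>e\<in>E. (\<Sum>d<N. c d * (of_nat (falling_fact d (snd e)) * x (fst e) ^ (d - snd e))) = 0"
    define P where "P = (\<Sum>d<N. monom (c d) d)"
    have coeff_P: "coeff P d = (if d < N then c d else 0)" for d
      by (auto simp: P_def coeff_sum)
    have "P \<in> vanishing_polys x N E"
      using 0 unfolding vanishing_polys_def
      by (auto simp: coeff_P) (auto simp: P_def poly_higher_pderiv_sum_monom mult.assoc)
    then have "P = 0" using p by (auto simp: poised_def)
    then show "\<forall>d\<in>{..<N}. c d = 0" using coeff_P by (metis coeff_0 lessThan_iff)
  qed
next
  assume tk: "trivial_kernel {..<N} E (\<lambda>d e. of_nat (falling_fact d (snd e)) * x (fst e) ^ (d - snd e))"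
  show "poised x N E" unfolding poised_def
  proof
    fix P assume P: "P \<in> vanishing_polys x N E"
    then have eq: "P = (\<Sum>d<N. monom (coeff P d) d)"
      by (intro poly_as_sum_monom_support) (auto simp: vanishing_polys_def)
    have "(\<Sum>d<N. coeff P d * (of_nat (falling_fact d (snd e)) * x (fst e) ^ (d - snd e))) = 0"
      if "e \<in> E" for e
    proof -
      have "poly ((pderiv ^^ snd e) P) (x (fst e)) = 0"
        using P that by (auto simp: vanishing_polys_def)
      then show ?thesis
        by (subst (asm) eq) (simp add: poly_higher_pderiv_sum_monom mult.assoc)
    qed
    then have "\<forall>d\<in>{..<N}. coeff P d = 0"
      using tk[unfolded trivial_kernel_def, rule_format, of "coeff P"] by auto
    then show "P \<in> {0}" by (subst eq) simp
  qed
qed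

text \<open>
  The lowest free order at node 0 can always be added: all lower orders at that node are already
  taken, so a violated bound at some \<open>k\<close> below it would force at least \<open>N\<close> conditions in \<open>E\<close>.
\<close>

lemma polya_extend:
  assumes "polya N E" "E \<subseteq> {..<m} \<times> UNIV" "m > 0"
  shows "\<exists>F. E \<subseteq> F \<and> F \<subseteq> {..<m} \<times> {..<N} \<and> polya N F \<and> card F = N"
  using assms
proof (induction "N - card E" arbitrary: E)
  case 0
  have "card E \<le> N" using 0(2) by (auto simp: polya_def dest: spec[of _ 0])
  then show ?case using 0 by (intro exI[of _ E]) (auto simp: polya_def)
next
  case (Suc n)
  have fin: "finite E" using Suc.prems by (simp add: polya_def)
  have "\<exists>j<N. (0, j) \<notin> E"
  proof (rule ccontr)
    assume "\<not> (\<exists>j<N. (0, j) \<notin> E)"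
    then have "card ({0::nat} \<times> {..<N}) \<le> card E" by (intro card_mono fin) auto
    then show False using Suc(2) by simp
  qed
  define j where "j = (LEAST j. (0, j) \<notin> E)"
  have j: "(0, j) \<notin> E" "j < N" "\<And>i. i < j \<Longrightarrow> (0, i) \<in> E"
  proof -
    obtain i where i: "i < N" "(0, i) \<notin> E" using \<open>\<exists>j<N. (0, j) \<notin> E\<close> by blast
    show "(0, j) \<notin> E" unfolding j_def by (rule LeastI[of _ i]) (rule i)
    have "j \<le> i" unfolding j_def by (rule Least_le) (rule i)
    then show "j < N" using i by simp
    show "(0, i) \<in> E" if "i < j" for i using that not_less_Least unfolding j_def by blast
  qed
  have "card {e \<in> insert (0, j) E. k \<le> snd e} \<le> N - k" if "k \<le> N" for k
  proof (cases "k \<le> j")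
    case False
    then have "{e \<in> insert (0, j) E. k \<le> snd e} = {e \<in> E. k \<le> snd e}" by auto
    then show ?thesis using Suc.prems(1) that by (simp add: polya_def)
  next
    case True
    have "card ({e \<in> E. k \<le> snd e} \<union> {0} \<times> {..<k}) \<le> card E"
      using j True by (intro card_mono fin) auto
    moreover have "card ({e \<in> E. k \<le> snd e} \<union> {0} \<times> {..<k}) = card {e \<in> E. k \<le> snd e} + k"
      using fin by (subst card_Un_disjoint) auto
    moreover have "{e \<in> insert (0, j) E. k \<le> snd e} = insert (0, j) {e \<in> E. k \<le> snd e}"
      using True by auto
    ultimately show ?thesis using Suc(2) fin j(1) by simp
  qed
  then have "polya N (insert (0, j) E)" using Suc.prems(1) j by (auto simp: polya_def)
  moreover have "n = N - card (insert (0, j) E)" using Suc(2) fin j by simp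
  ultimately show ?case using Suc(1)[of "insert (0, j) E"] Suc.prems by auto
qed

lemma obtain_lowest_subset:
  fixes f :: "'a \<Rightarrow> 'b::linorder"
  assumes "finite A" "s \<le> card A"
  shows "\<exists>F\<subseteq>A. card F = s \<and> (\<forall>a\<in>F. \<forall>b\<in>A - F. f a \<le> f b)"
  using assms(2)
proof (induction s)
  case 0
  show ?case by (intro exI[of _ "{}"]) auto
next
  case (Suc s)
  then obtain F where F: "F \<subseteq> A" "card F = s" "\<forall>a\<in>F. \<forall>b\<in>A - F. f a \<le> f b" by auto
  have fin: "finite F" "finite (A - F)" using F assms finite_subset by auto
  have "card (A - F) > 0" using F fin Suc.prems by (simp add: card_Diff_subset)
  then have "A - F \<noteq> {}" by (metis card.empty less_irrefl)
  then obtain a where a: "a \<in> A - F" "\<And>b. b \<in> A - F \<Longrightarrow> f a \<le> f b"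
    using arg_min_if_finite(1)[OF fin(2), of f] arg_min_least[OF fin(2), of _ f] by blast
  show ?case using F fin a by (intro exI[of _ "insert a F"]) auto
qed

text \<open>
  By \<open>low\<close>, the orders in \<open>J\<close> and the conditions in \<open>E\<close> together supply enough conditions of low
  order. On polynomials of degree less than \<open>k\<close>, the set \<open>F\<close> is to fill the dimensions that \<open>J\<close>
  leaves over. Taking the conditions of lowest order works: if \<open>F\<close> had too many conditions
  of order at least \<open>l\<close>, it would contain every condition of \<open>E\<close> of order below \<open>l\<close>, and then be
  too large.
\<close>

lemma polya_lowest_conditions:
  assumes "finite E"
    and low: "\<And>l. l \<le> k \<Longrightarrow> l \<le> card (J \<inter> {..<l}) + card {e \<in> E. snd e < l}"
  shows "\<exists>F\<subseteq>E. polya k F \<and> card F + card (J \<inter> {..<k}) = k"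
proof -
  define A where "A = {e \<in> E. snd e < k}"
  define s where "s = k - card (J \<inter> {..<k})"
  have Jk: "card (J \<inter> {..<l}) \<le> l" for l
    using card_mono[of "{..<l}" "J \<inter> {..<l}"] by simp
  have fA: "finite A" using assms by (simp add: A_def)
  have "s \<le> card A" using low[of k] by (simp add: s_def A_def)
  then obtain F where F: "F \<subseteq> A" "card F = s" "\<forall>a\<in>F. \<forall>b\<in>A - F. snd a \<le> snd b"
    using obtain_lowest_subset[OF fA, of s snd] by blast
  have fF: "finite F" using F(1) fA finite_subset by blast
  have "card {e \<in> F. l \<le> snd e} \<le> k - l" if l: "l \<le> k" for l
  proof (rule ccontr)
    assume "\<not> ?thesis"
    then have big: "k - l < card {e \<in> F. l \<le> snd e}" by simp
    then have "{e \<in> F. l \<le> snd e} \<noteq> {}" by (metis card.empty not_less_zero)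
    then obtain e where e: "e \<in> F" "l \<le> snd e" by auto
    have "b \<in> F" if "b \<in> E" "snd b < l" for b
    proof (rule ccontr)
      assume "b \<notin> F"
      then have "snd e \<le> snd b" using F(3) e(1) that l by (auto simp: A_def)
      then show False using e(2) that(2) by simp
    qed
    then have "{e \<in> E. snd e < l} \<subseteq> {e \<in> F. snd e < l}" by blast
    then have "card {e \<in> E. snd e < l} \<le> card {e \<in> F. snd e < l}"
      using fF by (intro card_mono) auto
    moreover have "card (J \<inter> {..<l}) \<le> card (J \<inter> {..<k})"
      using l by (intro card_mono) auto
    moreover have "card F = card {e \<in> F. snd e < l} + card {e \<in> F. l \<le> snd e}"
      using fF by (subst card_Un_disjoint[symmetric]) (auto intro!: arg_cong[where f = card])
    ultimately show False using low[OF l] big F(2) Jk[of k] l by (simp add: s_def)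
  qed
  then have "polya k F" using F fF by (auto simp: polya_def A_def)
  then show ?thesis using F Jk[of k] by (intro exI[of _ F]) (auto simp: s_def A_def)
qed

lemma distinct_degrees_independent:
  fixes f :: "nat \<Rightarrow> 'a::idom poly"
  assumes "finite A" "\<And>d. d \<in> A \<Longrightarrow> f d \<noteq> 0 \<and> degree (f d) = d"
    and sum0: "(\<Sum>d\<in>A. Polynomial.smult (c d) (f d)) = 0"
  shows "\<forall>d\<in>A. c d = 0"
proof (rule ccontr)
  assume nz: "\<not> ?thesis"
  define B where "B = {d \<in> A. c d \<noteq> 0}"
  have B: "finite B" "B \<noteq> {}" using assms nz by (auto simp: B_def)
  define t where "t = Max B"
  have t: "t \<in> A" "c t \<noteq> 0" using Max_in[OF B] by (auto simp: t_def B_def)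
  have "c d * coeff (f d) t = 0" if "d \<in> A - {t}" for d
  proof (cases "c d = 0")
    case False
    then have "d \<le> t" using that B by (auto simp: t_def B_def)
    then show ?thesis using that assms(2)[of d] by (simp add: coeff_eq_0)
  qed simp
  then have "(\<Sum>d\<in>A. c d * coeff (f d) t) = c t * coeff (f t) t"
    using sum.remove[OF assms(1) t(1), of "\<lambda>d. c d * coeff (f d) t"] by (simp add: sum.neutral)
  moreover have "(\<Sum>d\<in>A. c d * coeff (f d) t) = coeff (\<Sum>d\<in>A. Polynomial.smult (c d) (f d)) t"
    by (simp add: coeff_sum)
  ultimately have "coeff (f t) t = 0" using sum0 t by simp
  then show False using assms(2)[OF t(1)] by (metis leading_coeff_0_iff)
qed

text \<open>
  Leading terms are cancelled one after the other. The point is that a basis of \<open>V\<close> has only one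
  member for each degree that occurs in \<open>V\<close>.
\<close>

lemma span_of_distinct_degrees:
  fixes V :: "'a::field poly set"
  assumes V: "\<And>P Q c. P \<in> V \<Longrightarrow> Q \<in> V \<Longrightarrow> P + Polynomial.smult c Q \<in> V"
    and D: "finite D" "\<And>P. P \<in> V \<Longrightarrow> P \<noteq> 0 \<Longrightarrow> degree P \<in> D"
    and f: "\<And>d. d \<in> D \<Longrightarrow> f d \<in> V \<and> f d \<noteq> 0 \<and> degree (f d) = d"
    and P: "P \<in> V"
  shows "\<exists>c. P = (\<Sum>d\<in>D. Polynomial.smult (c d) (f d))"
  using P
proof (induction "degree P" arbitrary: P rule: less_induct)
  case less
  show ?case
  proof (cases "P = 0")
    case True
    then show ?thesis by (intro exI[of _ "\<lambda>_. 0"]) simp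
  next
    case False
    define t where "t = degree P"
    define q where "q = coeff P t / coeff (f t) t"
    define Q where "Q = P + Polynomial.smult (- q) (f t)"
    have t: "t \<in> D" using D less.prems False by (auto simp: t_def)
    have ft: "f t \<in> V" "coeff (f t) t \<noteq> 0" "degree (f t) = t"
      using f[OF t] by (auto, metis leading_coeff_0_iff)
    have "Q \<in> V" unfolding Q_def by (intro V less.prems ft)
    have "\<exists>c. Q = (\<Sum>d\<in>D. Polynomial.smult (c d) (f d))"
    proof (cases "Q = 0")
      case True
      then show ?thesis by (intro exI[of _ "\<lambda>_. 0"]) simp
    next
      case False
      have "degree Q \<le> t"
        unfolding Q_def by (rule degree_add_le) (use ft in \<open>auto simp: t_def degree_smult_eq\<close>)
      moreover have "coeff Q t = 0" using ft by (simp add: Q_def q_def)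
      ultimately have "degree Q < degree P"
        using False by (metis le_neq_implies_less leading_coeff_0_iff t_def)
      then show ?thesis using less.hyps \<open>Q \<in> V\<close> by blast
    qed
    then obtain c where c: "Q = (\<Sum>d\<in>D. Polynomial.smult (c d) (f d))" ..
    have "P = Q + Polynomial.smult q (f t)" by (simp add: Q_def)
    also have "\<dots> = (\<Sum>d\<in>D. Polynomial.smult (c d) (f d))
        + (\<Sum>d\<in>D. Polynomial.smult (if d = t then q else 0) (f d))"
      using t D(1) by (simp add: c if_distrib[of "\<lambda>a. Polynomial.smult a _"] cong: if_cong)
    also have "\<dots> = (\<Sum>d\<in>D. Polynomial.smult (c d + (if d = t then q else 0)) (f d))"
      by (simp add: sum.distrib smult_add_left)
    finally show ?thesis by (intro exI[of _ "\<lambda>d. c d + (if d = t then q else 0)"])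
  qed
qed

text \<open>
  The bound \<open>N\<close> leaves only finitely many sets of conditions, so that a new node can be chosen
  to suit all of them at once.
\<close>

definition poised_nodes :: "nat \<Rightarrow> nat \<Rightarrow> (nat \<Rightarrow> complex) \<Rightarrow> bool" where
  "poised_nodes N m x \<longleftrightarrow>
     (\<forall>k\<le>N. \<forall>F. F \<subseteq> {..<m} \<times> {..<k} \<and> polya k F \<and> card F = k \<longrightarrow> poised x k F)"

text \<open>
  The conditions \<open>F\<close> chosen from \<open>E\<close> extend to a poised set \<open>G\<close> on polynomials of degree less than
  \<open>k\<close>, and the extension adds as many conditions as \<open>J\<close> has orders below \<open>k\<close>. Members of the
  vanishing space with distinct degrees below \<open>k\<close> are separated by these additional conditions, so
  there cannot be more of them.
\<close>

lemma card_degrees_vanishing_polys_le: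
  assumes x: "poised_nodes N m x" and E: "finite E" "E \<subseteq> {..<m} \<times> UNIV" and "k \<le> N"
    and low: "\<And>l. l \<le> k \<Longrightarrow> l \<le> card (J \<inter> {..<l}) + card {e \<in> E. snd e < l}"
  shows "card (degree ` (vanishing_polys x N E - {0}) \<inter> {..<k}) \<le> card (J \<inter> {..<k})"
proof -
  define A where "A = degree ` (vanishing_polys x N E - {0}) \<inter> {..<k}"
  have A: "finite A" "card A \<le> k"
    using card_mono[of "{..<k}" A] by (auto simp: A_def)
  obtain F where F: "F \<subseteq> E" "polya k F" "card F + card (J \<inter> {..<k}) = k"
    using polya_lowest_conditions[OF E(1) low] by blast
  show ?thesis
  proof (cases "F = {}")
    case True
    then show ?thesis using F A by (simp add: A_def)
  next
    case False
    then have "m > 0" using F E by auto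
    then obtain G where G: "F \<subseteq> G" "G \<subseteq> {..<m} \<times> {..<k}" "polya k G" "card G = k"
      using polya_extend[OF F(2), of m] F E by blast
    have fG: "finite G" using G by (simp add: polya_def)
    have "\<forall>d\<in>A. \<exists>P. P \<in> vanishing_polys x N E \<and> P \<noteq> 0 \<and> degree P = d" by (auto simp: A_def)
    then obtain f where f: "\<And>d. d \<in> A \<Longrightarrow> f d \<in> vanishing_polys x N E \<and> f d \<noteq> 0 \<and> degree (f d) = d"
      by metis
    have "trivial_kernel A (G - F) (\<lambda>d e. poly ((pderiv ^^ snd e) (f d)) (x (fst e)))"
      unfolding trivial_kernel_def
    proof (intro allI impI)
      fix c assume 0: "\<forall>e\<in>G - F. (\<Sum>d\<in>A. c d * poly ((pderiv ^^ snd e) (f d)) (x (fst e))) = 0"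
      define P where "P = (\<Sum>d\<in>A. Polynomial.smult (c d) (f d))"
      have PV: "P \<in> vanishing_polys x N E" unfolding P_def
        by (intro vanishing_polys_sum vanishing_polys_smult) (use f in auto)
      have "coeff P d = 0" if "d \<ge> k" for d
        unfolding P_def coeff_sum
        by (rule sum.neutral) (use f that in \<open>force simp: A_def coeff_eq_0\<close>)
      moreover have "poly ((pderiv ^^ snd e) P) (x (fst e)) = 0" if "e \<in> G" for e
      proof (cases "e \<in> F")
        case True
        then show ?thesis using PV F(1) by (fastforce simp: vanishing_polys_def)
      next
        case False
        then show ?thesis using 0 that
          by (simp add: P_def higher_pderiv_sum higher_pderiv_smult poly_sum)
      qed
      ultimately have "P \<in> vanishing_polys x k G" by (fastforce simp: vanishing_polys_def)
      moreover have "poised x k G" using x G \<open>k \<le> N\<close> by (auto simp: poised_nodes_def)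
      ultimately have "P = 0" by (auto simp: poised_def)
      then show "\<forall>d\<in>A. c d = 0"
        using distinct_degrees_independent[OF A(1), of f c] f by (simp add: P_def)
    qed
    then have "card A \<le> card (G - F)" using A fG by (intro trivial_kernel_card_le) auto
    also have "\<dots> = card (J \<inter> {..<k})" using G F fG finite_subset[OF G(1) fG]
      by (simp add: card_Diff_subset)
    finally show ?thesis by (simp add: A_def)
  qed
qed

text \<open>
  A combination of the powers with exponents in \<open>D\<close> whose derivatives of the orders in \<open>J\<close>
  vanish at 1 would have at least as many vanishing orders up to its degree as it has terms.
\<close>

lemma falling_fact_trivial_kernel:
  assumes "finite D" "finite J"
    and count: "\<And>d. d \<in> D \<Longrightarrow> card (D \<inter> {..d}) \<le> card (J \<inter> {..d})"
  shows "trivial_kernel D J (\<lambda>d j. of_nat (falling_fact d j) :: complex)"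
  unfolding trivial_kernel_def
proof (intro allI impI)
  fix c :: "nat \<Rightarrow> complex"
  assume 0: "\<forall>j\<in>J. (\<Sum>d\<in>D. c d * of_nat (falling_fact d j)) = 0"
  define p where "p = (\<Sum>d\<in>D. monom (c d) d)"
  have coeff_p: "coeff p d = (if d \<in> D then c d else 0)" for d
    using assms(1) by (simp add: p_def coeff_sum)
  have "p = 0"
  proof (rule ccontr)
    assume "p \<noteq> 0"
    then have t: "degree p \<in> D" using coeff_p[of "degree p"] by (auto split: if_splits)
    have "card (J \<inter> {..degree p}) \<le> card {j. j \<le> degree p \<and> poly ((pderiv ^^ j) p) 1 = 0}"
      using 0 by (intro card_mono) (auto simp: p_def poly_higher_pderiv_sum_monom)
    also have "\<dots> < card {d. coeff p d \<noteq> 0}"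
      using card_vanishing_derivs_less_card_support[OF \<open>p \<noteq> 0\<close>] .
    also have "\<dots> \<le> card (D \<inter> {..degree p})"
      by (intro card_mono) (auto simp: coeff_p le_degree split: if_splits)
    also have "\<dots> \<le> card (J \<inter> {..degree p})" by (rule count[OF t])
    finally show False by simp
  qed
  then show "\<forall>d\<in>D. c d = 0" using coeff_p by (metis coeff_0)
qed

text \<open>
  The new node \<open>1 / u\<close> moves to infinity. Let \<open>V\<close> be the space cut out by the conditions at the old
  nodes and \<open>D\<close> the set of degrees in it. After the substitution of \<open>y / u\<close> for the variable, a
  member of \<open>V\<close> of degree \<open>d\<close> tends, up to a factor, to \<open>y ^ d\<close>, and the new node is 1.
  So the conditions at the new node become, in the limit, conditions at 1 on polynomials with
  exponents in \<open>D\<close>. That limit system has trivial kernel, because the count of degrees in \<open>D\<close> is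
  controlled by the induction hypothesis \<open>x\<close>, and triviality persists for small \<open>u\<close>.
\<close>

lemma eventually_poised_far_node:
  assumes x: "poised_nodes N m x" and "k \<le> N"
    and E: "E \<subseteq> {..<Suc m} \<times> {..<k}" "polya k E" "card E = k"
  shows "\<forall>\<^sub>F u in at 0. poised (x(m := 1 / u)) k E"
proof -
  define E' where "E' = {e \<in> E. fst e < m}"
  define J where "J = {j. (m, j) \<in> E}"
  define V where "V = vanishing_polys x k E'"
  define D where "D = degree ` (V - {0})"
  have finE: "finite E" using E by (simp add: polya_def)
  have x': "poised_nodes k m x" using x \<open>k \<le> N\<close> by (auto simp: poised_nodes_def)
  have split: "E = E' \<union> Pair m ` J" 
  proof -
    have "fst e < m \<or> fst e = m" if "e \<in> E" for e
      using E(1) that by (metis less_Suc_eq lessThan_iff mem_Times_iff subsetD)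
    then show ?thesis by (fastforce simp: E'_def J_def)
  qed
  have finJ: "finite J" by (rule finite_imageD[of "Pair m"], rule finite_subset[OF _ finE])
    (auto simp: J_def inj_on_def)
  have finE': "finite E'" "E' \<subseteq> {..<m} \<times> UNIV" using finE by (auto simp: E'_def)
  have low: "l \<le> card (J \<inter> {..<l}) + card {e \<in> E'. snd e < l}" if "l \<le> k" for l
  proof -
    have "card {e \<in> E. l \<le> snd e} \<le> k - l" using E that by (simp add: polya_def)
    moreover have "card E = card {e \<in> E. l \<le> snd e} + card {e \<in> E. snd e < l}"
      using finE by (subst card_Un_disjoint[symmetric]) (auto intro!: arg_cong[where f = card])
    moreover have "{e \<in> E. snd e < l} = Pair m ` (J \<inter> {..<l}) \<union> {e \<in> E'. snd e < l}"
      using split by auto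
    moreover have "card (Pair m ` (J \<inter> {..<l}) \<union> {e \<in> E'. snd e < l})
        \<le> card (J \<inter> {..<l}) + card {e \<in> E'. snd e < l}"
      by (rule order.trans[OF card_Un_le]) (simp add: card_image inj_on_def)
    ultimately show ?thesis using E(3) that by simp
  qed
  have Dk: "D \<subseteq> {..<k}"
  proof
    fix d assume "d \<in> D"
    then obtain P where P: "P \<in> V" "P \<noteq> 0" "d = degree P" by (auto simp: D_def)
    then have "coeff P d \<noteq> 0" by simp
    then show "d \<in> {..<k}" using P(1) by (force simp: V_def vanishing_polys_def not_le)
  qed
  then have finD: "finite D" using finite_subset by blast
  have count: "card (D \<inter> {..d}) \<le> card (J \<inter> {..d})" if "d \<in> D" for d
    using card_degrees_vanishing_polys_le[OF x' finE', of "Suc d" J] low Dk that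
    unfolding D_def V_def lessThan_Suc_atMost by fastforce
  have "\<exists>f. f \<in> V \<and> f \<noteq> 0 \<and> degree f = d \<and> coeff f d = 1" if d: "d \<in> D" for d
  proof -
    obtain P where P: "P \<in> V" "P \<noteq> 0" "degree P = d" using d by (auto simp: D_def)
    then show ?thesis
      by (intro exI[of _ "Polynomial.smult (1 / coeff P d) P"]) (auto simp: V_def vanishing_polys_smult)
  qed
  then obtain f where f: "\<And>d. d \<in> D \<Longrightarrow> f d \<in> V \<and> f d \<noteq> 0 \<and> degree (f d) = d \<and> coeff (f d) d = 1"
    by metis
  \<comment> \<open>The derivative of order \<open>j\<close> of \<open>u ^ d * f d (y / u)\<close> at \<open>y = 1\<close>.\<close>
  define g where "g d j u = (\<Sum>c\<le>d. coeff (f d) c * of_nat (falling_fact c j) * u ^ (d - c))"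
    for d j :: nat and u :: complex
  have g0: "g d j 0 = of_nat (falling_fact d j)" if "d \<in> D" for d j
  proof -
    have "g d j 0 = (\<Sum>c\<le>d. if c = d then of_nat (falling_fact d j) else 0)"
      unfolding g_def by (rule sum.cong) (use f[OF that] in auto)
    then show ?thesis by simp
  qed
  have tk0: "trivial_kernel D J (\<lambda>d j. g d j 0)"
    using falling_fact_trivial_kernel[OF finD finJ count] g0 by (simp add: trivial_kernel_def)
  have gc: "isCont (g d j) 0" for d j
    unfolding g_def[abs_def] by (intro continuous_intros)
  have "\<exists>r\<in>{h :: complex \<Rightarrow> complex. isCont h 0}. r 0 \<noteq> 0 \<and>
      (\<forall>u. r u \<noteq> 0 \<longrightarrow> trivial_kernel D J (\<lambda>d j. g d j u))"
    by (intro trivial_kernel_open_condition) (use finD tk0 gc in \<open>auto intro: continuous_intros\<close>)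
  then obtain r where r: "isCont r 0" "r 0 \<noteq> (0::complex)"
    "\<And>u. r u \<noteq> 0 \<Longrightarrow> trivial_kernel D J (\<lambda>d j. g d j u)" by blast
  have "\<forall>\<^sub>F u in at 0. r u \<noteq> 0"
    using r(1,2) unfolding isCont_def by (rule tendsto_imp_eventually_ne)
  moreover have "\<forall>\<^sub>F u in at 0. u \<noteq> (0::complex)" by (rule eventually_neq_at_within)
  ultimately show ?thesis
  proof eventually_elim
    case (elim u)
    have deriv: "poly ((pderiv ^^ j) (f d)) (1 / u) = (u ^ j * (1 / u) ^ d) * g d j u"
      if "d \<in> D" for d j
    proof -
      have "f d = (\<Sum>c\<le>d. monom (coeff (f d) c) c)"
        by (rule poly_as_sum_monom_support) (use f[OF that] in \<open>auto simp: coeff_eq_0\<close>)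
      then have "poly ((pderiv ^^ j) (f d)) (1 / u)
          = (\<Sum>c\<le>d. coeff (f d) c * of_nat (falling_fact c j) * (1 / u) ^ (c - j))"
        using poly_higher_pderiv_sum_monom[of j "coeff (f d)" "{..d}" "1 / u"] by simp
      also have "\<dots> = (\<Sum>c\<le>d. (u ^ j * (1 / u) ^ d) *
          (coeff (f d) c * of_nat (falling_fact c j) * u ^ (d - c)))"
      proof (rule sum.cong)
        fix c assume "c \<in> {..d}"
        then have c: "c \<le> d" by simp
        show "coeff (f d) c * of_nat (falling_fact c j) * (1 / u) ^ (c - j)
            = (u ^ j * (1 / u) ^ d) * (coeff (f d) c * of_nat (falling_fact c j) * u ^ (d - c))"
        proof (cases "j \<le> c")
          case False
          then show ?thesis by (simp add: falling_fact_def)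
        next
          case True
          have "u ^ d = u ^ j * u ^ (c - j) * u ^ (d - c)"
            using True c by (simp flip: power_add)
          then have "(1 / u) ^ (c - j) = u ^ j * (1 / u) ^ d * u ^ (d - c)"
            using elim(2) by (simp add: field_simps)
          then show ?thesis by simp
        qed
      qed simp
      finally show ?thesis by (simp add: g_def sum_distrib_left)
    qed
    show "poised (x(m := 1 / u)) k E" unfolding poised_def
    proof
      fix P assume P: "P \<in> vanishing_polys (x(m := 1 / u)) k E"
      then have "P \<in> V" by (force simp: vanishing_polys_def V_def E'_def)
      then obtain c where c: "P = (\<Sum>d\<in>D. Polynomial.smult (c d) (f d))"
        using span_of_distinct_degrees[of V D f P] finD f
        by (auto simp: D_def V_def vanishing_polys_add vanishing_polys_smult)
      have "(\<Sum>d\<in>D. (c d * (1 / u) ^ d) * g d j u) = 0" if "j \<in> J" for j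
      proof -
        have "0 = poly ((pderiv ^^ j) P) (1 / u)"
          using P that by (force simp: vanishing_polys_def J_def)
        also have "\<dots> = u ^ j * (\<Sum>d\<in>D. (c d * (1 / u) ^ d) * g d j u)"
          by (simp add: c higher_pderiv_sum higher_pderiv_smult poly_sum deriv sum_distrib_left
              algebra_simps)
        finally show ?thesis using elim by simp
      qed
      then have "\<forall>d\<in>D. c d * (1 / u) ^ d = 0"
        using r(3)[OF elim(1), unfolded trivial_kernel_def, THEN spec[of _ "\<lambda>d. c d * (1 / u) ^ d"]]
        by blast
      then show "P \<in> {0}" using elim(2) by (simp add: c)
    qed
  qed
qed

theorem exists_poised_nodes: "\<exists>x. poised_nodes N m x"
proof (induction m)
  case 0
  have "poised x 0 F" for x :: "nat \<Rightarrow> complex" and F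
    by (auto simp: poised_def vanishing_polys_def poly_eq_iff)
  then show ?case by (auto simp: poised_nodes_def)
next
  case (Suc m)
  then obtain x where x: "poised_nodes N m x" by blast
  define T where "T = {(k, E). k \<le> N \<and> E \<subseteq> {..<Suc m} \<times> {..<k} \<and> polya k E \<and> card E = k}"
  have "T \<subseteq> {..N} \<times> Pow ({..<Suc m} \<times> {..<N})" by (fastforce simp: T_def)
  then have "finite T" by (rule finite_subset) simp
  then have "\<forall>\<^sub>F u in at 0. \<forall>(k, E)\<in>T. poised (x(m := 1 / u)) k E"
    by (rule eventually_ball_finite)
      (use eventually_poised_far_node[OF x] in \<open>auto simp: T_def\<close>)
  then have "\<exists>u. \<forall>(k, E)\<in>T. poised (x(m := 1 / u)) k E"
    by (rule eventually_happens'[OF at_neq_bot])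
  then show ?case by (fastforce simp: poised_nodes_def T_def)
qed

section \<open>Polynomial functions with rational coefficients\<close>

definition monomial_value :: "(nat \<Rightarrow>\<^sub>0 nat) \<Rightarrow> (nat \<Rightarrow> complex) \<Rightarrow> complex" where
  "monomial_value \<mu> x = (\<Prod>i\<in>Poly_Mapping.keys \<mu>. x i ^ Poly_Mapping.lookup \<mu> i)"

lemma monomial_value_superset:
  assumes "finite T" "Poly_Mapping.keys \<mu> \<subseteq> T"
  shows "monomial_value \<mu> x = (\<Prod>i\<in>T. x i ^ Poly_Mapping.lookup \<mu> i)"
  unfolding monomial_value_def
  by (rule prod.mono_neutral_left) (use assms in \<open>auto simp: in_keys_iff\<close>)

lemma monomial_value_add:
  "monomial_value (\<mu> + \<nu>) x = monomial_value \<mu> x * monomial_value \<nu> x"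
proof -
  let ?T = "Poly_Mapping.keys \<mu> \<union> Poly_Mapping.keys \<nu>"
  have "Poly_Mapping.keys (\<mu> + \<nu>) \<subseteq> ?T" by (rule keys_add)
  then show ?thesis
    by (simp add: monomial_value_superset[of ?T] lookup_add power_add prod.distrib)
qed

lemma eval_mpoly_superset:
  assumes "finite T" "Poly_Mapping.keys R \<subseteq> T"
  shows "eval_mpoly R x = (\<Sum>\<mu>\<in>T. of_rat (Poly_Mapping.lookup R \<mu>) * monomial_value \<mu> x)"
  unfolding eval_mpoly_def monomial_value_def
  by (rule sum.mono_neutral_left) (use assms in \<open>auto simp: in_keys_iff\<close>)

lemma eval_mpoly_zero [simp]: "eval_mpoly 0 x = 0"
  by (simp add: eval_mpoly_def)

lemma eval_mpoly_add: "eval_mpoly (R + R') x = eval_mpoly R x + eval_mpoly R' x"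
proof -
  let ?T = "Poly_Mapping.keys R \<union> Poly_Mapping.keys R'"
  have "Poly_Mapping.keys (R + R') \<subseteq> ?T" by (rule keys_add)
  then show ?thesis
    by (simp add: eval_mpoly_superset[of ?T] lookup_add of_rat_add sum.distrib distrib_right)
qed

lemma eval_mpoly_sum: "eval_mpoly (\<Sum>a\<in>A. f a) x = (\<Sum>a\<in>A. eval_mpoly (f a) x)"
  by (induction A rule: infinite_finite_induct) (simp_all add: eval_mpoly_add)

lemma eval_mpoly_single:
  "eval_mpoly (Poly_Mapping.single \<mu> c) x = of_rat c * monomial_value \<mu> x"
  by (subst eval_mpoly_superset[of "{\<mu>}"]) auto

lemma in_variables_sum:
  "(\<And>a. a \<in> A \<Longrightarrow> in_variables m (f a)) \<Longrightarrow> in_variables m (\<Sum>a\<in>A. f a)"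
proof (induction A rule: infinite_finite_induct)
  case (insert a A)
  then show ?case
    using keys_add[of "f a" "\<Sum>a\<in>A. f a"] by (fastforce simp: in_variables_def)
qed (auto simp: in_variables_def)

text \<open>
  Closure under the ring operations is what the elimination needs. Working with the functions
  avoids relating evaluation to the convolution product of formal polynomials.
\<close>

definition rational_polynomial_maps :: "nat \<Rightarrow> ((nat \<Rightarrow> complex) \<Rightarrow> complex) set" where
  "rational_polynomial_maps m = {f. \<exists>R. in_variables m R \<and> (\<forall>x. f x = eval_mpoly R x)}"

lemma rational_polynomial_maps_sum:
  assumes "\<And>a. a \<in> A \<Longrightarrow> f a \<in> rational_polynomial_maps m"
  shows "(\<lambda>x. \<Sum>a\<in>A. f a x) \<in> rational_polynomial_maps m"
proof -
  obtain R where R: "\<And>a. a \<in> A \<Longrightarrow> in_variables m (R a) \<and> (\<forall>x. f a x = eval_mpoly (R a) x)"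
    using assms unfolding rational_polynomial_maps_def mem_Collect_eq by metis
  then have "(\<Sum>a\<in>A. f a x) = eval_mpoly (\<Sum>a\<in>A. R a) x" for x
    by (simp add: eval_mpoly_sum)
  moreover have "in_variables m (\<Sum>a\<in>A. R a)" by (rule in_variables_sum) (use R in blast)
  ultimately show ?thesis unfolding rational_polynomial_maps_def by blast
qed

lemma rational_polynomial_maps_monomial:
  assumes "Poly_Mapping.keys \<mu> \<subseteq> {..<m}"
  shows "(\<lambda>x. of_rat c * monomial_value \<mu> x) \<in> rational_polynomial_maps m"
proof -
  have "in_variables m (Poly_Mapping.single \<mu> c)"
    using assms by (simp add: in_variables_def)
  then show ?thesis
    unfolding rational_polynomial_maps_def by (auto simp flip: eval_mpoly_single)
qed

lemma rational_polynomial_maps_mult: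
  assumes "f \<in> rational_polynomial_maps m" "g \<in> rational_polynomial_maps m"
  shows "(\<lambda>x. f x * g x) \<in> rational_polynomial_maps m"
proof -
  obtain R R' where R: "in_variables m R" "\<And>x. f x = eval_mpoly R x"
    and R': "in_variables m R'" "\<And>x. g x = eval_mpoly R' x"
    using assms by (auto simp: rational_polynomial_maps_def)
  have "f x * g x = (\<Sum>\<mu>\<in>Poly_Mapping.keys R. \<Sum>\<nu>\<in>Poly_Mapping.keys R'.
      of_rat (Poly_Mapping.lookup R \<mu> * Poly_Mapping.lookup R' \<nu>) * monomial_value (\<mu> + \<nu>) x)" for x
    unfolding R(2) R'(2) eval_mpoly_superset[OF finite_keys order_refl] sum_product
    by (intro sum.cong refl) (simp only: monomial_value_add of_rat_mult mult_ac)
  moreover have "Poly_Mapping.keys (\<mu> + \<nu>) \<subseteq> {..<m}"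
    if "\<mu> \<in> Poly_Mapping.keys R" "\<nu> \<in> Poly_Mapping.keys R'" for \<mu> \<nu>
    using keys_add[of \<mu> \<nu>] that R(1) R'(1) by (fastforce simp: in_variables_def)
  ultimately show ?thesis
    by (simp add: rational_polynomial_maps_sum rational_polynomial_maps_monomial)
qed

lemma rational_polynomial_maps_const: "(\<lambda>x. of_rat c) \<in> rational_polynomial_maps m"
  using rational_polynomial_maps_monomial[of 0 m c] by (simp add: monomial_value_def)

lemma rational_polynomial_maps_variable:
  "i < m \<Longrightarrow> (\<lambda>x. x i) \<in> rational_polynomial_maps m"
  using rational_polynomial_maps_monomial[of "Poly_Mapping.single i 1" m 1]
  by (simp add: monomial_value_def)

lemma rational_polynomial_maps_power:
  assumes "f \<in> rational_polynomial_maps m"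
  shows "(\<lambda>x. f x ^ k) \<in> rational_polynomial_maps m"
proof (induction k)
  case 0
  show ?case using rational_polynomial_maps_const[of 1 m] by simp
next
  case (Suc k)
  then show ?case using rational_polynomial_maps_mult[OF assms] by simp
qed

lemma rational_polynomial_maps_diff:
  assumes "f \<in> rational_polynomial_maps m" "g \<in> rational_polynomial_maps m"
  shows "(\<lambda>x. f x - g x) \<in> rational_polynomial_maps m"
proof -
  have "(\<lambda>x. of_rat (-1) * g x) \<in> rational_polynomial_maps m"
    by (intro rational_polynomial_maps_mult rational_polynomial_maps_const assms)
  then obtain R R' where R: "in_variables m R" "\<And>x. f x = eval_mpoly R x"
    and R': "in_variables m R'" "\<And>x. - g x = eval_mpoly R' x"
    using assms(1) by (auto simp: rational_polynomial_maps_def)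
  have "in_variables m (R + R')"
    using keys_add[of R R'] R(1) R'(1) by (fastforce simp: in_variables_def)
  moreover have "f x - g x = eval_mpoly (R + R') x" for x
    using R(2)[of x] R'(2)[of x] by (simp add: eval_mpoly_add)
  ultimately show ?thesis unfolding rational_polynomial_maps_def by blast
qed

section \<open>Unique solvability at generic tuples\<close>

lemma higher_pderiv_pcompose_linear:
  fixes P :: "'a::idom poly"
  shows "(pderiv ^^ j) (pcompose P [:a, b:]) = Polynomial.smult (b ^ j) (pcompose ((pderiv ^^ j) P) [:a, b:])"
  by (induction j) (simp_all add: pderiv_smult pderiv_pcompose pderiv_pCons mult.commute)

lemma poised_affine:
  assumes "b \<noteq> 0" "poised (\<lambda>i. a + b * x i) N E"
  shows "poised x N E"
  unfolding poised_def
proof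
  fix P assume P: "P \<in> vanishing_polys x N E"
  define Q where "Q = pcompose P [:- a / b, 1 / b:]"
  have "coeff Q d = 0" if "d \<ge> N" for d
  proof (cases "P = 0")
    case False
    then have "degree P < N" using P by (force simp: vanishing_polys_def not_less[symmetric])
    then show ?thesis using assms(1) that
      by (intro coeff_eq_0) (simp add: Q_def degree_pcompose)
  qed (simp add: Q_def)
  moreover have "poly ((pderiv ^^ j) Q) (a + b * x i) = 0" if "(i, j) \<in> E" for i j
  proof -
    have "poly ((pderiv ^^ j) P) (x i) = 0" using P that by (auto simp: vanishing_polys_def)
    moreover have "- a / b + (a + b * x i) * (1 / b) = x i" using assms(1) by (simp add: field_simps)
    ultimately show ?thesis by (simp add: Q_def higher_pderiv_pcompose_linear poly_pcompose)
  qed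
  ultimately have "Q \<in> vanishing_polys (\<lambda>i. a + b * x i) N E" by (auto simp: vanishing_polys_def)
  then have "Q = 0" using assms(2) by (auto simp: poised_def)
  then show "P \<in> {0}" using assms(1) by (simp add: Q_def pcompose_eq_0_iff)
qed

text \<open>
  Elimination at the one known good tuple \<open>x0\<close> produces a rational polynomial \<open>R\<close>, nonzero because it
  does not vanish at \<open>x0\<close>, whose nonvanishing at a tuple implies unique solvability there. By
  genericity \<open>R\<close> does not vanish at some affine image of \<open>\<Lambda>\<close>, and affine maps do not affect
  solvability.
\<close>

lemma poised_of_affinely_algebraically_independent:
  assumes \<Lambda>: "affinely_algebraically_independent \<Lambda>"
    and F: "F \<subseteq> {..<length \<Lambda>} \<times> {..<k}" "polya k F" "card F = k"
  shows "poised (\<lambda>i. \<Lambda> ! i) k F"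
proof -
  define m where "m = length \<Lambda>"
  define M where "M d e x = of_nat (falling_fact d (snd e)) * x (fst e) ^ (d - snd e)"
    for d and e :: "nat \<times> nat" and x :: "nat \<Rightarrow> complex"
  have poised_iff: "poised x k F \<longleftrightarrow> trivial_kernel {..<k} F (\<lambda>d e. M d e x)" for x
    by (simp add: poised_iff_trivial_kernel M_def)
  obtain x0 where "poised_nodes k m x0" using exists_poised_nodes by blast
  then have x0: "trivial_kernel {..<k} F (\<lambda>d e. M d e x0)"
    using F unfolding poised_iff[symmetric] by (auto simp: poised_nodes_def m_def)
  have "M d e \<in> rational_polynomial_maps m" if "e \<in> F" for d e
  proof -
    have "fst e < m" using F(1) that by (auto simp: m_def)
    then have "(\<lambda>x. of_rat (of_nat (falling_fact d (snd e))) * x (fst e) ^ (d - snd e))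
        \<in> rational_polynomial_maps m"
      by (intro rational_polynomial_maps_mult rational_polynomial_maps_const
          rational_polynomial_maps_power rational_polynomial_maps_variable)
    then show ?thesis by (simp add: M_def[abs_def])
  qed
  then have "\<exists>r\<in>rational_polynomial_maps m. r x0 \<noteq> 0 \<and>
      (\<forall>x. r x \<noteq> 0 \<longrightarrow> trivial_kernel {..<k} F (\<lambda>d e. M d e x))"
    by (intro trivial_kernel_open_condition)
      (use rational_polynomial_maps_const[of 1 m] x0 in
        \<open>auto intro: rational_polynomial_maps_mult rational_polynomial_maps_diff\<close>)
  then obtain R where R: "in_variables m R" "eval_mpoly R x0 \<noteq> 0"
    "\<And>x. eval_mpoly R x \<noteq> 0 \<Longrightarrow> poised x k F"
    unfolding rational_polynomial_maps_def poised_iff by auto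
  then have "R \<noteq> 0" by auto
  then have "\<not> affine_algebraic_dependence \<Lambda> R"
    using \<Lambda> by (auto simp: affinely_algebraically_independent_def)
  then obtain a b where ab: "eval_mpoly R (\<lambda>i. a + b * \<Lambda> ! i) \<noteq> 0"
    using R(1) by (auto simp: affine_algebraic_dependence_def m_def)
  \<comment> \<open>The value of \<open>b\<close> might be 0, which collapses the nodes to one point; move it slightly.\<close>
  have "isCont (\<lambda>b. eval_mpoly R (\<lambda>i. a + b * \<Lambda> ! i)) b"
    unfolding eval_mpoly_def by (intro continuous_intros)
  then have "\<forall>\<^sub>F b in at b. eval_mpoly R (\<lambda>i. a + b * \<Lambda> ! i) \<noteq> 0"
    using ab unfolding isCont_def by (rule tendsto_imp_eventually_ne)
  moreover have "\<forall>\<^sub>F b in at b. b \<noteq> 0" by (rule eventually_neq_at_within)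
  ultimately have "\<forall>\<^sub>F b in at b. b \<noteq> 0 \<and> eval_mpoly R (\<lambda>i. a + b * \<Lambda> ! i) \<noteq> 0"
    by eventually_elim simp
  then obtain b' where "b' \<noteq> 0" "eval_mpoly R (\<lambda>i. a + b' * \<Lambda> ! i) \<noteq> 0"
    using eventually_happens'[OF at_neq_bot] by blast
  then show ?thesis using poised_affine R(3) by blast
qed

section \<open>Existence of generic tuples\<close>

definition algebraically_independent :: "nat \<Rightarrow> (nat \<Rightarrow> complex) \<Rightarrow> bool" where
  "algebraically_independent m x \<longleftrightarrow>
     (\<forall>R. in_variables m R \<and> eval_mpoly R x = 0 \<longrightarrow> R = 0)"

lemma countable_UNIV_poly_mapping:
  assumes "countable (UNIV :: 'a set)" "countable (UNIV :: 'b::comm_monoid_add set)"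
  shows "countable (UNIV :: ('a \<Rightarrow>\<^sub>0 'b) set)"
proof -
  have lists: "countable (lists (UNIV :: ('a \<times> 'b) set))"
    using assms by (intro countable_lists) (simp flip: UNIV_Times_UNIV)
  have surj: "R \<in> (\<lambda>xs. \<Sum>(k, v)\<leftarrow>xs. Poly_Mapping.single k v) ` lists UNIV"
    for R :: "'a \<Rightarrow>\<^sub>0 'b"
  proof -
    obtain ks where ks: "distinct ks" "set ks = Poly_Mapping.keys R"
      using finite_distinct_list[OF finite_keys[of R]] by auto
    let ?xs = "map (\<lambda>k. (k, Poly_Mapping.lookup R k)) ks"
    have "(\<Sum>(k, v)\<leftarrow>?xs. Poly_Mapping.single k v)
        = (\<Sum>k\<in>Poly_Mapping.keys R. Poly_Mapping.single k (Poly_Mapping.lookup R k))"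
      using ks by (simp add: sum_list_distinct_conv_sum_set comp_def)
    also have "\<dots> = R"
      by (intro poly_mapping_eqI)
        (simp add: lookup_sum lookup_single when_def in_keys_iff)
    finally show ?thesis by (intro image_eqI[of _ _ ?xs]) auto
  qed
  show ?thesis
    by (rule countable_subset[OF _ countable_image[OF lists]], rule subsetI, rule surj)
qed

text \<open>
  A relation involving the new coordinate makes it a root of one of countably many polynomials.
  These are nonzero: some coefficient with respect to the new variable is the value of a nonzero
  rational polynomial at the old coordinates, which are algebraically independent.
\<close>

lemma algebraically_independent_extend:
  assumes x: "algebraically_independent m x"
  shows "\<exists>z. algebraically_independent (Suc m) (x(m := z))"
proof -
  \<comment> \<open>The exponent vector \<open>\<mu>\<close> with the exponent of the new variable set to 0.\<close>
  let ?red = "\<lambda>\<mu> :: nat \<Rightarrow>\<^sub>0 nat. \<mu> - Poly_Mapping.single m (Poly_Mapping.lookup \<mu> m)"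
  let ?lk = "Poly_Mapping.lookup"
  define p :: "rat_mpoly \<Rightarrow> complex poly" where
    "p R = (\<Sum>\<mu>\<in>Poly_Mapping.keys R. monom (of_rat (?lk R \<mu>) * monomial_value (?red \<mu>) x) (?lk \<mu> m))" for R
  have red: "\<mu> = ?red \<mu> + Poly_Mapping.single m (?lk \<mu> m)" for \<mu>
    by (intro poly_mapping_eqI) (simp add: lookup_add lookup_minus lookup_single when_def)
  have red_m: "m \<notin> Poly_Mapping.keys (?red \<mu>)" for \<mu>
    by (simp add: in_keys_iff lookup_minus)
  have red_val: "monomial_value (?red \<mu>) (x(m := z)) = monomial_value (?red \<mu>) x" for \<mu> z
    unfolding monomial_value_def by (rule prod.cong) (use red_m[of \<mu>] in auto)
  have single_val: "monomial_value (Poly_Mapping.single m j) (x(m := z)) = z ^ j" for j z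
    by (simp add: monomial_value_def)
  have poly_p: "poly (p R) z = eval_mpoly R (x(m := z))" for R z
    unfolding eval_mpoly_superset[OF finite_keys order_refl] p_def poly_sum poly_monom
  proof (rule sum.cong)
    fix \<mu>
    have "monomial_value \<mu> (x(m := z)) = monomial_value (?red \<mu>) x * z ^ ?lk \<mu> m"
      using monomial_value_add[of "?red \<mu>" "Poly_Mapping.single m (?lk \<mu> m)" "x(m := z)"]
      by (simp only: red[symmetric] red_val single_val)
    then show "of_rat (?lk R \<mu>) * monomial_value (?red \<mu>) x * z ^ ?lk \<mu> m
        = of_rat (?lk R \<mu>) * monomial_value \<mu> (x(m := z))" by simp
  qed simp
  have p_nz: "p R \<noteq> 0" if R: "R \<noteq> 0" "in_variables (Suc m) R" for R
  proof -
    obtain \<mu>0 where \<mu>0: "\<mu>0 \<in> Poly_Mapping.keys R" using R(1) by (metis ex_in_conv keys_eq_empty)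
    define d where "d = ?lk \<mu>0 m"
    define K where "K = {\<mu> \<in> Poly_Mapping.keys R. ?lk \<mu> m = d}"
    define R' where "R' = (\<Sum>\<mu>\<in>K. Poly_Mapping.single (?red \<mu>) (?lk R \<mu>))"
    have K: "finite K" "\<mu>0 \<in> K" using \<mu>0 by (auto simp: K_def d_def)
    have "coeff (p R) d = eval_mpoly R' x"
    proof -
      have "coeff (p R) d = (\<Sum>\<mu>\<in>Poly_Mapping.keys R.
          if ?lk \<mu> m = d then of_rat (?lk R \<mu>) * monomial_value (?red \<mu>) x else 0)"
        by (simp add: p_def coeff_sum)
      also have "\<dots> = (\<Sum>\<mu>\<in>K. of_rat (?lk R \<mu>) * monomial_value (?red \<mu>) x)"
        unfolding K_def by (rule sum.inter_filter[symmetric]) simp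
      finally show ?thesis by (simp add: R'_def eval_mpoly_sum eval_mpoly_single)
    qed
    moreover have "in_variables m R'" unfolding R'_def
    proof (rule in_variables_sum)
      fix \<mu> assume "\<mu> \<in> K"
      then have "Poly_Mapping.keys \<mu> \<subseteq> {..<Suc m}"
        using R(2) by (auto simp: K_def in_variables_def)
      moreover have "Poly_Mapping.keys (?red \<mu>) \<subseteq> Poly_Mapping.keys \<mu>"
        by (auto simp: in_keys_iff lookup_minus)
      ultimately have "Poly_Mapping.keys (?red \<mu>) \<subseteq> {..<m}"
        using red_m[of \<mu>] by (metis lessThan_Suc subset_insert order_trans)
      then show "in_variables m (Poly_Mapping.single (?red \<mu>) (?lk R \<mu>))"
        by (auto simp: in_variables_def)
    qed
    moreover have "R' \<noteq> 0"
    proof -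
      have "?red \<mu> = ?red \<mu>0 \<longleftrightarrow> \<mu> = \<mu>0" if "\<mu> \<in> K" for \<mu>
      proof
        assume eq: "?red \<mu> = ?red \<mu>0"
        have "?lk \<mu> m = ?lk \<mu>0 m" using that K(2) by (simp add: K_def)
        then show "\<mu> = \<mu>0" using eq red[of \<mu>] red[of \<mu>0] by metis
      qed simp
      then have "?lk R' (?red \<mu>0) = (\<Sum>\<mu>\<in>K. if \<mu> = \<mu>0 then ?lk R \<mu>0 else 0)"
        unfolding R'_def lookup_sum by (intro sum.cong) (auto simp: lookup_single when_def)
      also have "\<dots> \<noteq> 0" using K \<mu>0 by (simp add: in_keys_iff)
      finally show ?thesis by auto
    qed
    ultimately have "coeff (p R) d \<noteq> 0" using x by (auto simp: algebraically_independent_def)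
    then show ?thesis by auto
  qed
  have "countable (UNIV :: rat_mpoly set)"
    by (intro countable_UNIV_poly_mapping countableI_type)
  then have "countable {R :: rat_mpoly. p R \<noteq> 0}" by (rule countable_subset[rotated]) simp
  then have "countable (\<Union>R\<in>{R. p R \<noteq> 0}. {z. poly (p R) z = 0})"
    by (rule countable_UN) (simp add: countable_finite poly_roots_finite)
  then obtain z where z: "z \<notin> (\<Union>R\<in>{R. p R \<noteq> 0}. {z. poly (p R) z = 0})"
    using uncountable_UNIV_complex by (metis (no_types) UNIV_eq_I)
  have "algebraically_independent (Suc m) (x(m := z))"
    unfolding algebraically_independent_def
  proof (intro allI impI, elim conjE)
    fix R assume R: "in_variables (Suc m) R" "eval_mpoly R (x(m := z)) = 0"
    then have "p R = 0" using z poly_p by auto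
    then show "R = 0" using p_nz R(1) by blast
  qed
  then show ?thesis by (intro exI)
qed

lemma exists_algebraically_independent: "\<exists>x. algebraically_independent m x"
proof (induction m)
  case 0
  have "R = 0" if "in_variables 0 R" "eval_mpoly R x = 0" for R x
  proof (rule ccontr)
    assume "R \<noteq> 0"
    have "Poly_Mapping.keys R \<subseteq> {0}" using that(1) by (auto simp: in_variables_def)
    then have "eval_mpoly R x = of_rat (Poly_Mapping.lookup R 0)"
      by (subst eval_mpoly_superset[of "{0}"]) (auto simp: monomial_value_def)
    moreover have "Poly_Mapping.lookup R 0 \<noteq> 0"
      using \<open>Poly_Mapping.keys R \<subseteq> {0}\<close> \<open>R \<noteq> 0\<close>
      by (metis in_keys_iff keys_eq_empty subset_singletonD singletonI)
    ultimately show False using that(2) by simp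
  qed
  then show ?case by (auto simp: algebraically_independent_def)
next
  case (Suc m)
  then obtain x where "algebraically_independent m x" ..
  from algebraically_independent_extend[OF this] show ?case by auto
qed

lemma generic_tuples_nonempty: "generic_tuples m \<noteq> {}"
proof -
  obtain x where x: "algebraically_independent m x"
    using exists_algebraically_independent by blast
  define \<Lambda> where "\<Lambda> = map x [0..<m]"
  have nth: "\<Lambda> ! i = x i" if "i < m" for i using that by (simp add: \<Lambda>_def)
  have "distinct \<Lambda>"
    unfolding distinct_conv_nth
  proof (intro allI impI)
    fix i j assume "i < length \<Lambda>" "j < length \<Lambda>" "i \<noteq> j"
    then have ij: "i < m" "j < m" "i \<noteq> j" by (auto simp: \<Lambda>_def)
    have "(\<lambda>x. x i - x j) \<in> rational_polynomial_maps m"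
      using ij by (intro rational_polynomial_maps_diff rational_polynomial_maps_variable)
    then obtain R where R: "in_variables m R" "\<And>x. x i - x j = eval_mpoly R x"
      by (auto simp: rational_polynomial_maps_def)
    have "R \<noteq> 0" using R(2)[of "\<lambda>k. if k = i then 1 else 0"] ij by auto
    then have "x i - x j \<noteq> 0" using x R by (auto simp: algebraically_independent_def)
    then show "\<Lambda> ! i \<noteq> \<Lambda> ! j" using ij nth by simp
  qed
  moreover have "affinely_algebraically_independent \<Lambda>"
    unfolding affinely_algebraically_independent_def
  proof (intro allI impI)
    fix R assume R: "affine_algebraic_dependence \<Lambda> R"
    then have vars: "in_variables m R" by (simp add: affine_algebraic_dependence_def \<Lambda>_def)
    have "eval_mpoly R (\<lambda>i. 0 + 1 * \<Lambda> ! i) = 0"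
      using R unfolding affine_algebraic_dependence_def by blast
    moreover have "monomial_value \<mu> (\<lambda>i. \<Lambda> ! i) = monomial_value \<mu> x"
      if "\<mu> \<in> Poly_Mapping.keys R" for \<mu>
      unfolding monomial_value_def
    proof (rule prod.cong)
      fix i assume "i \<in> Poly_Mapping.keys \<mu>"
      then have "i < m" using vars that by (auto simp: in_variables_def)
      then show "\<Lambda> ! i ^ Poly_Mapping.lookup \<mu> i = x i ^ Poly_Mapping.lookup \<mu> i"
        by (simp add: nth)
    qed simp
    ultimately have "eval_mpoly R x = 0"
      by (simp add: eval_mpoly_superset[OF finite_keys order_refl])
    then show "R = 0" using x vars by (auto simp: algebraically_independent_def)
  qed
  ultimately show ?thesis by (auto simp: generic_tuples_def \<Lambda>_def)
qed

section \<open>Dope matrices of generic tuples\<close>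

lemma higher_pderiv_nonzero:
  fixes P :: "complex poly"
  assumes "P \<noteq> 0" "k \<le> degree P"
  shows "(pderiv ^^ k) P \<noteq> 0"
proof -
  have "pochhammer (of_nat (Suc (degree P - k)) :: complex) k = of_nat (pochhammer (Suc (degree P - k)) k)"
    by (rule pochhammer_of_nat)
  moreover have "pochhammer (Suc (degree P - k)) k > 0" by (rule pochhammer_pos) simp
  ultimately have "coeff ((pderiv ^^ k) P) (degree P - k) \<noteq> 0"
    using assms by (simp add: coeff_higher_pderiv del: of_nat_Suc)
  then show ?thesis by auto
qed

text \<open>
  Consider the least \<open>k\<close> that violates the bound, and \<open>k + 1\<close> of the offending conditions, read as
  conditions on the derivative of order \<open>n - k\<close>, which has degree \<open>k\<close>. Minimality of \<open>k\<close> gives the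
  Polya condition, so this derivative would be zero.
\<close>

lemma card_vanishing_derivs_generic_le:
  fixes P :: "complex poly"
  assumes \<Lambda>: "affinely_algebraically_independent \<Lambda>" and P: "P \<noteq> 0" "degree P = n"
    and "k \<le> n"
  shows "card {(i, j). i < length \<Lambda> \<and> n - k \<le> j \<and> j \<le> n \<and> poly ((pderiv ^^ j) P) (\<Lambda> ! i) = 0} \<le> k"
  using \<open>k \<le> n\<close>
proof (induction k rule: less_induct)
  case (less k)
  define Z where "Z l = {(i, j). i < length \<Lambda> \<and> n - l \<le> j \<and> j \<le> n \<and>
    poly ((pderiv ^^ j) P) (\<Lambda> ! i) = 0}" for l
  have finZ: "finite (Z l)" for l
    by (rule finite_subset[of _ "{..<length \<Lambda>} \<times> {..n}"]) (auto simp: Z_def)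
  have IH: "card (Z l) \<le> l" if "l < k" for l
    using less that by (simp add: Z_def)
  define shift :: "nat \<times> nat \<Rightarrow> nat \<times> nat" where "shift = (\<lambda>(i, j). (i, j - (n - k)))"
  have "card (Z k) \<le> k"
  proof (rule ccontr)
    assume "\<not> card (Z k) \<le> k"
    have "inj_on shift (Z k)" by (auto simp: inj_on_def shift_def Z_def)
    then have "card (shift ` Z k) = card (Z k)" by (rule card_image)
    then have "Suc k \<le> card (shift ` Z k)" using \<open>\<not> card (Z k) \<le> k\<close> by simp
    then obtain F where F: "F \<subseteq> shift ` Z k" "card F = Suc k" "finite F"
      by (rule obtain_subset_with_card_n)
    have Fsub: "F \<subseteq> {..<length \<Lambda>} \<times> {..<Suc k}"
      using F(1) less.prems by (auto simp: shift_def Z_def)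
    have "card {e \<in> F. l \<le> snd e} \<le> Suc k - l" if l: "l \<le> Suc k" for l
    proof -
      consider "l = 0" | "l = Suc k" | "0 < l" "l \<le> k" using l by linarith
      then show ?thesis
      proof cases
        case 1
        then show ?thesis using F(2) by simp
      next
        case 2
        then have "{e \<in> F. l \<le> snd e} = {}" using Fsub by force
        then have "card {e \<in> F. l \<le> snd e} = 0" by (simp only: card.empty)
        then show ?thesis by simp
      next
        case 3
        have "{e \<in> F. l \<le> snd e} \<subseteq> shift ` Z (k - l)"
        proof
          fix e assume e: "e \<in> {e \<in> F. l \<le> snd e}"
          then obtain i j where ij: "(i, j) \<in> Z k" "e = shift (i, j)" using F(1) by auto
          then have "(i, j) \<in> Z (k - l)" using e 3 less.prems by (auto simp: Z_def shift_def)
          then show "e \<in> shift ` Z (k - l)" using ij by blast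
        qed
        then have "card {e \<in> F. l \<le> snd e} \<le> card (Z (k - l))"
          by (rule surj_card_le[OF finZ])
        also have "\<dots> \<le> k - l" using 3 by (intro IH) simp
        finally show ?thesis by simp
      qed
    qed
    then have "polya (Suc k) F" using F(3) Fsub by (auto simp: polya_def)
    then have "poised (\<lambda>i. \<Lambda> ! i) (Suc k) F"
      using poised_of_affinely_algebraically_independent[OF \<Lambda> Fsub] F(2) by blast
    moreover have "(pderiv ^^ (n - k)) P \<in> vanishing_polys (\<lambda>i. \<Lambda> ! i) (Suc k) F"
      unfolding vanishing_polys_def
    proof (intro CollectI conjI allI impI ballI)
      fix d assume "Suc k \<le> d"
      then show "coeff ((pderiv ^^ (n - k)) P) d = 0"
        using P less.prems by (intro coeff_eq_0) (simp add: degree_higher_pderiv)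
    next
      fix e assume "e \<in> F"
      then obtain i j where ij: "(i, j) \<in> Z k" "e = shift (i, j)" using F(1) by auto
      have "(pderiv ^^ (j - (n - k))) ((pderiv ^^ (n - k)) P) = (pderiv ^^ j) P"
        using ij(1) by (simp add: Z_def flip: funpow_add[unfolded comp_def, THEN fun_cong])
      then show "case e of (i, j) \<Rightarrow> poly ((pderiv ^^ j) ((pderiv ^^ (n - k)) P)) (\<Lambda> ! i) = 0"
        using ij by (simp add: Z_def shift_def)
    qed
    moreover have "(pderiv ^^ (n - k)) P \<noteq> 0" using P by (intro higher_pderiv_nonzero) auto
    ultimately show False by (auto simp: poised_def)
  qed
  then show ?case by (simp add: Z_def)
qed

text \<open>
  Without \<open>e\<close> there are fewer conditions than coefficients, hence a nonzero solution; it cannot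
  satisfy \<open>e\<close> as well.
\<close>

lemma poised_dual_poly:
  assumes "poised x k F" "finite F" "card F = k" "e \<in> F"
  shows "\<exists>P\<in>vanishing_polys x k (F - {e}). poly ((pderiv ^^ snd e) P) (x (fst e)) \<noteq> 0"
proof -
  have "card (F - {e}) < k" using assms by (metis card_Diff1_less)
  then have "\<not> poised x k (F - {e})"
    unfolding poised_iff_trivial_kernel using assms(2)
    by (metis (no_types, lifting) card_lessThan finite_Diff finite_lessThan not_less trivial_kernel_card_le)
  then obtain P where P: "P \<in> vanishing_polys x k (F - {e})" "P \<noteq> 0"
    by (auto simp: poised_def)
  have "P \<notin> vanishing_polys x k F" using P(2) assms(1) by (auto simp: poised_def)
  then have "poly ((pderiv ^^ snd e) P) (x (fst e)) \<noteq> 0"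
    using P(1) by (fastforce simp: vanishing_polys_def)
  then show ?thesis using P(1) by blast
qed

text \<open>
  A vector space over an infinite field is not a finite union of proper subspaces.
\<close>

lemma simultaneously_nonvanishing:
  assumes "finite B"
    and "\<And>e. e \<in> B \<Longrightarrow>
      \<exists>P\<in>vanishing_polys x N E. poly ((pderiv ^^ snd e) P) (x (fst e)) \<noteq> 0"
  shows "\<exists>P\<in>vanishing_polys x N E. \<forall>e\<in>B. poly ((pderiv ^^ snd e) P) (x (fst e)) \<noteq> 0"
  using assms
proof (induction B rule: finite_induct)
  case empty
  have "0 \<in> vanishing_polys x N E" by (auto simp: vanishing_polys_def)
  then show ?case by blast
next
  case (insert e B)
  define L where "L b P = poly ((pderiv ^^ snd b) P) (x (fst b))" for b P
  obtain P where P: "P \<in> vanishing_polys x N E" "\<And>b. b \<in> B \<Longrightarrow> L b P \<noteq> 0"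
    using insert by (auto simp: L_def)
  obtain Q where Q: "Q \<in> vanishing_polys x N E" "L e Q \<noteq> 0"
    using insert.prems[of e] by (auto simp: L_def)
  have "finite ((\<lambda>b. - L b P / L b Q) ` insert e B)" using insert.hyps(1) by simp
  then obtain c where c: "c \<notin> (\<lambda>b. - L b P / L b Q) ` insert e B"
    using ex_new_if_finite[OF infinite_UNIV_char_0] by blast
  have "L b (P + Polynomial.smult c Q) \<noteq> 0" if b: "b \<in> insert e B" for b
  proof
    assume "L b (P + Polynomial.smult c Q) = 0"
    then have 0: "L b P + c * L b Q = 0"
      by (simp add: L_def higher_pderiv_add higher_pderiv_smult)
    show False
    proof (cases "L b Q = 0")
      case True
      then show ?thesis using 0 b P(2)[of b] Q(2) by (cases "b = e") auto
    next
      case False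
      then have "c = - L b P / L b Q" using 0 by (simp add: field_simps add_eq_0_iff)
      then show ?thesis using c b by blast
    qed
  qed
  then show ?case using P(1) Q(1) unfolding L_def
    by (intro bexI[of _ "P + Polynomial.smult c Q"] vanishing_polys_add vanishing_polys_smult) auto
qed

text \<open>
  The bound in \<open>count\<close> is stricter by one than the Polya condition for \<open>N = n + 1\<close>. Hence one
  further condition \<open>e\<close> may be added to \<open>E\<close>, and a polynomial that satisfies \<open>E\<close> but violates
  \<open>e\<close> exists. As \<open>E\<close> contains no condition of order \<open>n\<close>, the condition \<open>(0, n)\<close> is one of those
  to be violated, and this forces the degree to be \<open>n\<close>.
\<close>

lemma exists_poly_with_exact_vanishing:
  assumes \<Lambda>: "affinely_algebraically_independent \<Lambda>" "\<Lambda> \<noteq> []"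
    and E: "E \<subseteq> {..<length \<Lambda>} \<times> {..n}"
    and count: "\<And>k. k \<le> n \<Longrightarrow> card {e \<in> E. n - k \<le> snd e} \<le> k"
  shows "\<exists>P. P \<noteq> 0 \<and> degree P = n \<and>
    (\<forall>i<length \<Lambda>. \<forall>j\<le>n. poly ((pderiv ^^ j) P) (\<Lambda> ! i) = 0 \<longleftrightarrow> (i, j) \<in> E)"
proof -
  define m where "m = length \<Lambda>"
  have m: "m > 0" using \<Lambda>(2) by (simp add: m_def)
  have finE: "finite E" using E finite_subset by blast
  let ?x = "\<lambda>i. \<Lambda> ! i"
  let ?B = "{..<m} \<times> {..n} - E"
  have "\<exists>P\<in>vanishing_polys ?x (Suc n) E. poly ((pderiv ^^ snd e) P) (?x (fst e)) \<noteq> 0"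
    if e: "e \<in> ?B" for e
  proof -
    have "card {a \<in> insert e E. l \<le> snd a} \<le> Suc n - l" if "l \<le> Suc n" for l
    proof (cases "l = Suc n")
      case True
      then have "{a \<in> insert e E. l \<le> snd a} = {}" using e E by force
      then have "card {a \<in> insert e E. l \<le> snd a} = 0" by (simp only: card.empty)
      then show ?thesis by simp
    next
      case False
      have "card {a \<in> insert e E. l \<le> snd a} \<le> card (insert e {a \<in> E. l \<le> snd a})"
        using finE by (intro card_mono) auto
      also have "\<dots> \<le> Suc (card {a \<in> E. l \<le> snd a})" by (simp add: card_insert_if finE)
      also have "card {a \<in> E. l \<le> snd a} \<le> n - l"
        using count[of "n - l"] False that by simp
      finally show ?thesis using False that by simp
    qed
    then have "polya (Suc n) (insert e E)" using e E finE by (force simp: polya_def)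
    moreover have "insert e E \<subseteq> {..<m} \<times> UNIV" using e E by (auto simp: m_def)
    ultimately obtain F where F: "insert e E \<subseteq> F" "F \<subseteq> {..<m} \<times> {..<Suc n}"
      "polya (Suc n) F" "card F = Suc n"
      using polya_extend[of "Suc n" "insert e E" m] m by auto
    have "poised ?x (Suc n) F"
      using poised_of_affinely_algebraically_independent[OF \<Lambda>(1)] F by (simp add: m_def)
    then obtain P where P: "P \<in> vanishing_polys ?x (Suc n) (F - {e})"
      "poly ((pderiv ^^ snd e) P) (?x (fst e)) \<noteq> 0"
      using poised_dual_poly[of ?x "Suc n" F e] F by (auto simp: polya_def)
    have "P \<in> vanishing_polys ?x (Suc n) E"
      using P(1) F(1) e by (fastforce simp: vanishing_polys_def)
    then show ?thesis using P(2) by blast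
  qed
  then obtain P where P: "P \<in> vanishing_polys ?x (Suc n) E"
    "\<And>e. e \<in> ?B \<Longrightarrow> poly ((pderiv ^^ snd e) P) (?x (fst e)) \<noteq> 0"
    using simultaneously_nonvanishing[of ?B ?x "Suc n" E] by auto
  have "{e \<in> E. n - 0 \<le> snd e} = {}" using count[of 0] finE by simp
  then have "(0, n) \<in> ?B" using m by auto
  then have top: "(pderiv ^^ n) P \<noteq> 0" using P(2) by fastforce
  have "degree P \<le> n" using P(1) by (intro degree_le) (auto simp: vanishing_polys_def)
  moreover have "\<not> degree P < n"
  proof
    assume "degree P < n"
    then have "(pderiv ^^ n) P = 0"
      by (intro poly_eqI) (simp add: coeff_higher_pderiv coeff_eq_0)
    then show False using top by simp
  qed
  moreover have "poly ((pderiv ^^ j) P) (\<Lambda> ! i) = 0 \<longleftrightarrow> (i, j) \<in> E" if "i < m" "j \<le> n" for i j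
    using P(1) P(2)[of "(i, j)"] that by (auto simp: vanishing_polys_def)
  moreover have "P \<noteq> 0" using top by auto
  ultimately show ?thesis by (intro exI[of _ P]) (auto simp: m_def)
qed

theorem dope_set_generic:
  assumes \<Lambda>: "affinely_algebraically_independent \<Lambda>" "\<Lambda> \<noteq> []" and m: "length \<Lambda> = m"
  shows "dope_set n \<Lambda> = {A \<in> carrier_mat m (n + 1).
     (\<forall>i<m. \<forall>j\<le>n. A $$ (i, j) \<in> {0, 1}) \<and>
     (\<forall>k\<le>n. card {(i, j). i < m \<and> n - k \<le> j \<and> j \<le> n \<and> A $$ (i, j) \<noteq> 0} \<le> k)}" (is "_ = ?S")
proof (rule equalityI; rule subsetI)
  fix A assume "A \<in> dope_set n \<Lambda>"
  then obtain P where P: "A = dope_matrix \<Lambda> P" "P \<noteq> 0" "degree P = n" by (auto simp: dope_set_def)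
  have A: "A $$ (i, j) = (if poly ((pderiv ^^ j) P) (\<Lambda> ! i) = 0 then 1 else 0)"
    if "i < m" "j \<le> n" for i j
    using that P m by (simp add: dope_matrix_def)
  have "{(i, j). i < m \<and> n - k \<le> j \<and> j \<le> n \<and> A $$ (i, j) \<noteq> 0}
     = {(i, j). i < length \<Lambda> \<and> n - k \<le> j \<and> j \<le> n \<and> poly ((pderiv ^^ j) P) (\<Lambda> ! i) = 0}" for k
    using A m by (auto split: if_splits)
  then have "card {(i, j). i < m \<and> n - k \<le> j \<and> j \<le> n \<and> A $$ (i, j) \<noteq> 0} \<le> k" if "k \<le> n" for k
    using card_vanishing_derivs_generic_le[OF \<Lambda>(1) P(2,3) that] by simp
  moreover have "A \<in> carrier_mat m (n + 1)" using P m by (simp add: dope_matrix_def)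
  ultimately show "A \<in> ?S" using A by auto
next
  fix A assume A: "A \<in> ?S"
  define E where "E = {(i, j). i < m \<and> j \<le> n \<and> A $$ (i, j) \<noteq> 0}"
  have "{e \<in> E. n - k \<le> snd e} = {(i, j). i < m \<and> n - k \<le> j \<and> j \<le> n \<and> A $$ (i, j) \<noteq> 0}" for k
    by (auto simp: E_def)
  then have "card {e \<in> E. n - k \<le> snd e} \<le> k" if "k \<le> n" for k using A that by simp
  moreover have "E \<subseteq> {..<length \<Lambda>} \<times> {..n}" using m by (auto simp: E_def)
  ultimately obtain P where P: "P \<noteq> 0" "degree P = n"
    "\<And>i j. i < m \<Longrightarrow> j \<le> n \<Longrightarrow> poly ((pderiv ^^ j) P) (\<Lambda> ! i) = 0 \<longleftrightarrow> (i, j) \<in> E"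
    using exists_poly_with_exact_vanishing[OF \<Lambda>, of E n] m by blast
  have "dope_matrix \<Lambda> P = A"
  proof (rule eq_matI)
    fix i j assume "i < dim_row A" "j < dim_col A"
    then have ij: "i < m" "j \<le> n" using A by auto
    have "A $$ (i, j) \<in> {0, 1}" using A ij by blast
    then show "dope_matrix \<Lambda> P $$ (i, j) = A $$ (i, j)"
      using P ij m by (auto simp: dope_matrix_def E_def)
  qed (use A P m in \<open>auto simp: dope_matrix_def\<close>)
  then show "A \<in> dope_set n \<Lambda>" using P(1,2) unfolding dope_set_def by blast
qed

theorem theorem1p1:
  fixes m n :: nat
  assumes "m > 0" and "n > 0"
  shows "dope_set n ` generic_tuples m = {generic_dope_set m n} \<and>
    generic_dope_set m n =
      {A \<in> carrier_mat m (n + 1).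
         (\<forall>i<m. \<forall>j\<le>n. A $$ (i, j) \<in> {0, 1}) \<and>
         (\<forall>k\<le>n. card {(i, j). i < m \<and> n - k \<le> j \<and> j \<le> n \<and> A $$ (i, j) \<noteq> 0} \<le> k)}"
    (is "_ \<and> _ = ?S")
proof -
  have "dope_set n \<Lambda> = ?S" if "\<Lambda> \<in> generic_tuples m" for \<Lambda>
    using that \<open>m > 0\<close> by (intro dope_set_generic) (auto simp: generic_tuples_def)
  then have image: "dope_set n ` generic_tuples m = {?S}"
    using generic_tuples_nonempty[of m] by auto
  then have "generic_dope_set m n = ?S" unfolding generic_dope_set_def by simp
  then show ?thesis using image by simp
qed

end
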